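(* On the space $L$ we have $\widehat{x}(z)^2=0$.
   Context: Let $q$ be an indeterminate, $F=\mathbb{C}(q^{1/2})$, $[m]=\frac{q^m-q^{-m}}{q-q^{-1}}$. Let $K(1)=F[a(-1),a(-2),\dots]$ be the polynomial algebra on which $a(-r)$ ($r\ge1$) acts by multiplication and $a(r)$ ($r\ge1$) acts as the derivation with $a(r)\cdot a(-s)=\delta_{rs}\frac{[2r][r]}{r}$. Let $P=\mathbb{Z}\lambda$, $\alpha=2\lambda$, $(\alpha,\alpha)=2$; $F\{P\}$ is the group algebra with basis $e^\mu$; $L=K(1)\otimes F\{P\}$; $z^{\partial_\alpha}e^\beta=z^{(\alpha,\beta)}e^\beta$. Define $$x^+(z)=\exp\Big(\sum_{r\ge1}\tfrac{q^{-r/2}}{[r]}a(-r)z^r\Big)\exp\Big(-\sum_{r\ge1}\tfrac{q^{-r/2}}{[r]}a(r)z^{-r}\Big)\otimes e^\alpha z^{\partial_\alpha},$$ $$\widehat{k}(z)=\exp\Big((q-q^{-1})\sum_{r\ge1}\tfrac{-q^{r/2}}{1+q^{2r}}a(r)z^{-r}\Big),\qquad \widehat{x}(z)=x^+(z)\widehat{k}(z)\in\mathrm{Hom}(L,L((z))).$$ The product $\widehat{x}(z_1)\widehat{x}(z_2)$ lies in $\mathrm{Hom}(L,L((z_1,z_2)))$, where $L((z_1,z_2))=L[[z_1,z_2]][z_1^{-1},z_2^{-1}]$, and $\widehat{x}(z)^2$ denotes its specialization at $z_1=z_2=z$. *)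

theory Defs
  imports
    "HOL-Computational_Algebra.Polynomial"
    "HOL-Computational_Algebra.Fraction_Field"
    "HOL-Library.Poly_Mapping"
begin

subsection \<open>The ground field \<open>F = \<complex>(q\<^sup>1\<^sup>/\<^sup>2)\<close>\<close>

type_synonym fld = "complex poly fract"

definition q_half :: fld  \<comment> \<open>the indeterminate \<open>q\<^sup>1\<^sup>/\<^sup>2\<close>\<close>
  where "q_half = Fract [:0, 1:] 1"

definition q_var :: fld
  where "q_var = q_half ^ 2"

definition qint :: "nat \<Rightarrow> fld"
  where "qint m = (q_var powi (int m) - q_var powi (- int m)) / (q_var - inverse q_var)"

subsection \<open>The Fock space \<open>K(1) = F[a(-1), a(-2), \<dots>]\<close>\<close>

text \<open>
  A monomial is a finitely supported exponent function. The generator \<open>a(-r)\<close>, \<open>r \<ge> 1\<close>, is the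
  variable with index \<open>r - 1\<close>, so that there is no superfluous variable. Operators \<open>a(\<plusminus>r)\<close> are
  only meant for \<open>r \<ge> 1\<close>.
\<close>

type_synonym fock = "(nat \<Rightarrow>\<^sub>0 nat) \<Rightarrow>\<^sub>0 fld"

definition gen :: "nat \<Rightarrow> fock"
  where "gen r = Poly_Mapping.single (Poly_Mapping.single (r - 1) 1) 1"

definition partial_deriv :: "nat \<Rightarrow> fock \<Rightarrow> fock"
  where "partial_deriv i p =
    (\<Sum>m\<in>Poly_Mapping.keys p.
       Poly_Mapping.single (m - Poly_Mapping.single i 1)
         (of_nat (Poly_Mapping.lookup m i) * Poly_Mapping.lookup p m))"

definition a_neg :: "nat \<Rightarrow> fock \<Rightarrow> fock"
  where "a_neg r p = gen r * p"

text \<open>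
  The derivation with \<open>a(r) a(-s) = \<delta>\<^sub>r\<^sub>s [2r][r]/r\<close>, written as a multiple of the partial derivative
  by \<open>a(-r)\<close>; see \<open>a_pos_gen\<close>, \<open>a_pos_add\<close>, \<open>a_pos_scale\<close> and \<open>a_pos_mult\<close> below.
\<close>

definition a_pos :: "nat \<Rightarrow> fock \<Rightarrow> fock"
  where "a_pos r p =
    Poly_Mapping.single 0 (qint (2 * r) * qint r / of_nat r) * partial_deriv (r - 1) p"

lemma partial_deriv_superset:
  assumes "finite S" "Poly_Mapping.keys p \<subseteq> S"
  shows "partial_deriv i p =
    (\<Sum>m\<in>S. Poly_Mapping.single (m - Poly_Mapping.single i 1)
       (of_nat (Poly_Mapping.lookup m i) * Poly_Mapping.lookup p m))"
  unfolding partial_deriv_def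
  by (rule sum.mono_neutral_left) (use assms in \<open>auto simp: in_keys_iff\<close>)

lemma partial_deriv_single:
  "partial_deriv i (Poly_Mapping.single m c) =
     Poly_Mapping.single (m - Poly_Mapping.single i 1) (of_nat (Poly_Mapping.lookup m i) * c)"
  by (subst partial_deriv_superset[of "{m}"]) auto

lemma partial_deriv_add: "partial_deriv i (p + p') = partial_deriv i p + partial_deriv i p'"
proof -
  let ?S = "Poly_Mapping.keys p \<union> Poly_Mapping.keys p'"
  have S: "finite ?S" "Poly_Mapping.keys (p + p') \<subseteq> ?S"
    by (auto dest: subsetD[OF keys_add])
  show ?thesis
    by (simp add: partial_deriv_superset[OF S] partial_deriv_superset[of ?S p]
        partial_deriv_superset[of ?S p'] lookup_add distrib_left single_add sum.distrib)
qed

lemma partial_deriv_zero: "partial_deriv i 0 = 0"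
  by (simp add: partial_deriv_def)

lemma fock_induct [case_names zero add]:
  fixes p :: fock
  assumes "P 0" and "\<And>m c p. P p \<Longrightarrow> P (Poly_Mapping.single m c + p)"
  shows "P p"
proof (induction p rule: update_induct)
  case const
  show ?case by (fact assms(1))
next
  case (update f a b)
  have "Poly_Mapping.update a b f = Poly_Mapping.single a b + f"
    using update by (intro poly_mapping_eqI)
      (auto simp: lookup_add lookup_single lookup_update when_def in_keys_iff)
  with assms(2) update show ?case by simp
qed

lemma partial_deriv_mult_single:
  "partial_deriv i (Poly_Mapping.single m c * Poly_Mapping.single n d) =
     partial_deriv i (Poly_Mapping.single m c) * Poly_Mapping.single n d +
     Poly_Mapping.single m c * partial_deriv i (Poly_Mapping.single n d)"
proof -
  let ?e = "Poly_Mapping.single i (1::nat)"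
  have 1: "m - ?e + n = m + n - ?e" if "Poly_Mapping.lookup m i \<noteq> 0"
    using that by (intro poly_mapping_eqI) (auto simp: lookup_add lookup_minus lookup_single when_def)
  have 2: "m + (n - ?e) = m + n - ?e" if "Poly_Mapping.lookup n i \<noteq> 0"
    using that by (intro poly_mapping_eqI) (auto simp: lookup_add lookup_minus lookup_single when_def)
  have 3: "Poly_Mapping.single (m - ?e + n) (of_nat (Poly_Mapping.lookup m i) * c * d) =
      Poly_Mapping.single (m + n - ?e) (of_nat (Poly_Mapping.lookup m i) * c * d)"
    using 1 by (cases "Poly_Mapping.lookup m i = 0") auto
  have 4: "Poly_Mapping.single (m + (n - ?e)) (c * (of_nat (Poly_Mapping.lookup n i) * d)) =
      Poly_Mapping.single (m + n - ?e) (c * (of_nat (Poly_Mapping.lookup n i) * d))"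
    using 2 by (cases "Poly_Mapping.lookup n i = 0") auto
  show ?thesis
    unfolding partial_deriv_single mult_single 3 4
    by (simp add: lookup_add algebra_simps flip: single_add)
qed

lemma partial_deriv_mult:
  "partial_deriv i (p * p') = partial_deriv i p * p' + p * partial_deriv i p'"
proof (induction p rule: fock_induct)
  case zero
  show ?case by (simp add: partial_deriv_zero)
next
  case (add m c p)
  have "partial_deriv i (Poly_Mapping.single m c * p') =
      partial_deriv i (Poly_Mapping.single m c) * p' + Poly_Mapping.single m c * partial_deriv i p'"
    by (induction p' rule: fock_induct)
      (simp_all add: partial_deriv_zero partial_deriv_add partial_deriv_mult_single algebra_simps)
  with add show ?case
    by (simp add: partial_deriv_add algebra_simps)
qed

lemma a_pos_gen:
  assumes "r \<ge> 1" "s \<ge> 1"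
  shows "a_pos r (gen s) =
    (if r = s then Poly_Mapping.single 0 (qint (2 * r) * qint r / of_nat r) else 0)"
  using assms
  by (auto simp: a_pos_def gen_def partial_deriv_single lookup_single mult_single when_def)

lemma a_pos_add: "a_pos r (p + p') = a_pos r p + a_pos r p'"
  by (simp add: a_pos_def partial_deriv_add algebra_simps)

lemma a_pos_mult: "a_pos r (p * p') = a_pos r p * p' + p * a_pos r p'"
  by (simp add: a_pos_def partial_deriv_mult algebra_simps)

lemma a_pos_scale: "a_pos r (Poly_Mapping.single 0 c * p) = Poly_Mapping.single 0 c * a_pos r p"
  by (simp add: a_pos_mult) (simp add: a_pos_def partial_deriv_single)

subsection \<open>The space \<open>L = K(1) \<otimes> F{P}\<close>\<close>

text \<open>
  The weight \<open>n\<lambda> \<in> P = \<int>\<lambda>\<close> is the integer \<open>n\<close>. Then \<open>K(1) \<otimes> F{P}\<close> is the free \<open>K(1)\<close>-module on the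
  \<open>e\<^sup>\<mu>\<close>, i.e. the group algebra of \<open>P\<close> over \<open>K(1)\<close>, where \<open>p \<otimes> e\<^sup>\<mu>\<close> is \<open>Poly_Mapping.single \<mu> p\<close>.
\<close>

type_synonym spc = "int \<Rightarrow>\<^sub>0 fock"

definition scaleL :: "fld \<Rightarrow> spc \<Rightarrow> spc"
  where "scaleL c v = Poly_Mapping.single 0 (Poly_Mapping.single 0 c) * v"

definition on_fock :: "(fock \<Rightarrow> fock) \<Rightarrow> spc \<Rightarrow> spc"  \<comment> \<open>\<open>T \<otimes> 1\<close>, for linear \<open>T\<close>\<close>
  where "on_fock T v = Poly_Mapping.map T v"

definition alpha :: int
  where "alpha = 2"

text \<open>
  From \<open>(\<alpha>, \<alpha>) = 2\<close> and \<open>\<alpha> = 2\<lambda>\<close> one gets \<open>(m\<lambda>, n\<lambda>) = m n / 2\<close>; the division is exact for \<open>m = alpha\<close>.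
\<close>

definition pair_alpha :: "int \<Rightarrow> int"
  where "pair_alpha \<beta> = (alpha * \<beta>) div 2"

subsection \<open>Operator-valued formal series\<close>

text \<open>
  A series \<open>A(z) = \<Sum>\<^sub>n A\<^sub>n z\<^sup>n\<close> with coefficients in \<open>End L\<close> is the family of its coefficients; a series
  in \<open>z\<^sub>1, z\<^sub>2\<close> is indexed by both exponents.
\<close>

type_synonym ser = "int \<Rightarrow> spc \<Rightarrow> spc"
type_synonym ser2 = "int \<Rightarrow> int \<Rightarrow> spc \<Rightarrow> spc"

definition Hom_L_Lz :: "ser set"  \<comment> \<open>\<open>Hom(L, L((z)))\<close>\<close>
  where "Hom_L_Lz = {A. (\<forall>n. Vector_Spaces.linear scaleL scaleL (A n)) \<and>
    (\<forall>v. \<exists>N. \<forall>n. A n v \<noteq> 0 \<longrightarrow> N \<le> n)}"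

definition Hom_L_Lzz :: "ser2 set"  \<comment> \<open>\<open>Hom(L, L[[z\<^sub>1,z\<^sub>2]][z\<^sub>1\<^sup>-\<^sup>1,z\<^sub>2\<^sup>-\<^sup>1])\<close>\<close>
  where "Hom_L_Lzz = {C. (\<forall>m n. Vector_Spaces.linear scaleL scaleL (C m n)) \<and>
    (\<forall>v. \<exists>N. \<forall>m n. C m n v \<noteq> 0 \<longrightarrow> N \<le> m \<and> N \<le> n)}"

definition prod2 :: "ser \<Rightarrow> ser \<Rightarrow> ser2"  \<comment> \<open>\<open>A(z\<^sub>1) B(z\<^sub>2)\<close>\<close>
  where "prod2 A B m n v = A m (B n v)"

text \<open>
  Setting \<open>z\<^sub>1 = z\<^sub>2 = z\<close>. This is meaningful only if for every \<open>k\<close> and \<open>v\<close> just finitely many terms are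
  nonzero, as is the case for elements of \<open>Hom_L_Lzz\<close>; \<open>Sum_any\<close> of infinitely many nonzero terms is
  by convention \<open>0\<close>.
\<close>

definition specialize :: "ser2 \<Rightarrow> ser"
  where "specialize C k v = Sum_any (\<lambda>m. C m (k - m) v)"

definition prod1 :: "ser \<Rightarrow> ser \<Rightarrow> ser"  (infixr \<open>\<odot>\<close> 70)  \<comment> \<open>\<open>A(z) B(z)\<close>\<close>
  where "A \<odot> B = specialize (prod2 A B)"

text \<open>
  Exponential of a power series \<open>A = \<Sum>\<^sub>r A\<^sub>r w\<^sup>r\<close> with \<open>A\<^sub>0 = 0\<close>: since \<open>A\<^sup>n\<close> starts in degree \<open>n\<close>, the
  coefficient of \<open>w\<^sup>k\<close> in \<open>\<Sum>\<^sub>n A\<^sup>n / n!\<close> only involves \<open>n \<le> k\<close>.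
\<close>

fun ops_power :: "(nat \<Rightarrow> spc \<Rightarrow> spc) \<Rightarrow> nat \<Rightarrow> nat \<Rightarrow> spc \<Rightarrow> spc" where
  "ops_power A 0 k v = (if k = 0 then v else 0)"
| "ops_power A (Suc n) k v = (\<Sum>i\<le>k. A i (ops_power A n (k - i) v))"

definition ops_exp :: "(nat \<Rightarrow> spc \<Rightarrow> spc) \<Rightarrow> nat \<Rightarrow> spc \<Rightarrow> spc"
  where "ops_exp A k v = (\<Sum>n\<le>k. scaleL (1 / of_nat (fact n)) (ops_power A n k v))"

definition in_z :: "(nat \<Rightarrow> spc \<Rightarrow> spc) \<Rightarrow> ser"  \<comment> \<open>\<open>w = z\<close>\<close>
  where "in_z A n v = (if n \<ge> 0 then A (nat n) v else 0)"

definition in_z_inverse :: "(nat \<Rightarrow> spc \<Rightarrow> spc) \<Rightarrow> ser"  \<comment> \<open>\<open>w = z\<^sup>-\<^sup>1\<close>\<close>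
  where "in_z_inverse A n v = (if n \<le> 0 then A (nat (- n)) v else 0)"

definition mode_series ::
    "(nat \<Rightarrow> fld) \<Rightarrow> (nat \<Rightarrow> fock \<Rightarrow> fock) \<Rightarrow> nat \<Rightarrow> spc \<Rightarrow> spc"  \<comment> \<open>\<open>\<Sum>\<^sub>r\<^sub>\<ge>\<^sub>1 c\<^sub>r T\<^sub>r w\<^sup>r\<close>\<close>
  where "mode_series c T r v = (if r = 0 then 0 else scaleL (c r) (on_fock (T r) v))"

subsection \<open>The vertex operators\<close>

text \<open>
  All products \<open>\<odot>\<close> below are finite sums on each vector, because \<open>e\<^sup>\<alpha> z\<^sup>\<partial>\<close> and
  \<open>exp(\<Sum> c\<^sub>r a(r) z\<^sup>-\<^sup>r)\<close> map every vector of \<open>L\<close> to a Laurent polynomial. For the latter see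
  \<open>finite_ops_exp_a_pos\<close>; its proof bounds the weights of monomials, where \<open>a(-r)\<close> has weight \<open>r\<close>.
\<close>

definition wt :: "(nat \<Rightarrow>\<^sub>0 nat) \<Rightarrow> int"
  where "wt m = (\<Sum>i\<in>Poly_Mapping.keys m. int (Suc i) * int (Poly_Mapping.lookup m i))"

definition wt_le :: "int \<Rightarrow> spc set"
  where "wt_le d =
    {v. \<forall>\<beta> m. Poly_Mapping.lookup (Poly_Mapping.lookup v \<beta>) m \<noteq> 0 \<longrightarrow> wt m \<le> d}"

lemma wt_superset:
  assumes "finite S" "Poly_Mapping.keys m \<subseteq> S"
  shows "wt m = (\<Sum>i\<in>S. int (Suc i) * int (Poly_Mapping.lookup m i))"
  unfolding wt_def
  by (rule sum.mono_neutral_left) (use assms in \<open>auto simp: in_keys_iff\<close>)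

lemma wt_nonneg: "0 \<le> wt m"
  unfolding wt_def by (intro sum_nonneg) auto

lemma wt_minus_single:
  assumes "Poly_Mapping.lookup m i \<noteq> 0"
  shows "wt (m - Poly_Mapping.single i 1) = wt m - int (Suc i)"
proof -
  let ?S = "Poly_Mapping.keys m"
  have i: "i \<in> ?S" using assms by (simp add: in_keys_iff)
  have "wt (m - Poly_Mapping.single i 1) =
      (\<Sum>j\<in>?S. int (Suc j) * int (Poly_Mapping.lookup (m - Poly_Mapping.single i 1) j))"
    by (rule wt_superset) (auto simp: in_keys_iff lookup_minus)
  also have "\<dots> = (\<Sum>j\<in>?S. int (Suc j) * int (Poly_Mapping.lookup m j) -
      (if j = i then int (Suc i) else 0))"
    using assms by (intro sum.cong) (auto simp: lookup_minus lookup_single when_def of_nat_diff algebra_simps)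
  also have "\<dots> = wt m - int (Suc i)"
    using i by (simp add: sum_subtractf wt_def)
  finally show ?thesis .
qed

lemma wt_le_zero: "0 \<in> wt_le d"
  by (simp add: wt_le_def)

lemma wt_le_negative: "v \<in> wt_le d \<Longrightarrow> d < 0 \<Longrightarrow> v = 0"
  unfolding wt_le_def
  by (intro poly_mapping_eqI) (use wt_nonneg in \<open>force simp: not_le[symmetric] intro: order.trans\<close>)

lemma wt_le_add: "v \<in> wt_le d \<Longrightarrow> w \<in> wt_le d \<Longrightarrow> v + w \<in> wt_le d"
  unfolding wt_le_def by (auto simp: lookup_add) (metis add.right_neutral)

lemma wt_le_sum: "(\<And>i. i \<in> I \<Longrightarrow> f i \<in> wt_le d) \<Longrightarrow> sum f I \<in> wt_le d"
  by (induction I rule: infinite_finite_induct) (auto simp: wt_le_zero wt_le_add)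

lemma lookup_scalar_mult:
  fixes c :: "'b::comm_semiring_1" and p :: "'a::comm_monoid_add \<Rightarrow>\<^sub>0 'b"
  shows "Poly_Mapping.lookup (Poly_Mapping.single 0 c * p) m = c * Poly_Mapping.lookup p m"
  by (simp flip: mult_map_scale_conv_mult add: map.rep_eq when_def)

lemma wt_le_scaleL: "v \<in> wt_le d \<Longrightarrow> scaleL c v \<in> wt_le d"
  unfolding wt_le_def scaleL_def by (auto simp: lookup_scalar_mult)

lemma wt_le_exists: "\<exists>d. v \<in> wt_le d"
proof -
  let ?M = "\<Union>\<beta>\<in>Poly_Mapping.keys v. wt ` Poly_Mapping.keys (Poly_Mapping.lookup v \<beta>)"
  have "finite ?M" by auto
  then have "wt m \<le> Max ?M" if "Poly_Mapping.lookup (Poly_Mapping.lookup v \<beta>) m \<noteq> 0" for \<beta> m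
    using that by (intro Max_ge) (auto simp: in_keys_iff intro!: bexI[of _ \<beta>] imageI)
  then show ?thesis unfolding wt_le_def by blast
qed

lemma wt_partial_deriv:
  assumes "Poly_Mapping.lookup (partial_deriv i p) m \<noteq> 0"
  shows "\<exists>m'. Poly_Mapping.lookup p m' \<noteq> 0 \<and> wt m = wt m' - int (Suc i)"
proof -
  from assms obtain m' where m': "m' \<in> Poly_Mapping.keys p"
    "Poly_Mapping.lookup (Poly_Mapping.single (m' - Poly_Mapping.single i 1)
       (of_nat (Poly_Mapping.lookup m' i) * Poly_Mapping.lookup p m')) m \<noteq> 0"
    unfolding partial_deriv_def lookup_sum by (meson sum.not_neutral_contains_not_neutral)
  then have "m = m' - Poly_Mapping.single i 1" "Poly_Mapping.lookup m' i \<noteq> 0"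
    by (auto simp: lookup_single when_def split: if_splits) (metis gr0I of_nat_0)
  with m' show ?thesis
    using wt_minus_single[of m' i] by (auto simp: in_keys_iff)
qed

lemma wt_le_a_pos:
  assumes "v \<in> wt_le d"
  shows "mode_series c a_pos r v \<in> wt_le (d - int r)"
proof (cases "r = 0")
  case True
  then show ?thesis by (simp add: mode_series_def wt_le_zero)
next
  case False
  have "wt m \<le> d - int r"
    if "Poly_Mapping.lookup (Poly_Mapping.lookup (on_fock (a_pos r) v) \<beta>) m \<noteq> 0" for \<beta> m
  proof -
    from that have "Poly_Mapping.lookup (partial_deriv (r - 1) (Poly_Mapping.lookup v \<beta>)) m \<noteq> 0"
      by (auto simp: on_fock_def map.rep_eq when_def a_pos_def lookup_scalar_mult split: if_splits)
    from wt_partial_deriv[OF this] show ?thesis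
      using assms False by (auto simp: wt_le_def)
  qed
  then have "on_fock (a_pos r) v \<in> wt_le (d - int r)"
    by (simp add: wt_le_def)
  with False show ?thesis by (simp add: mode_series_def wt_le_scaleL)
qed

lemma wt_le_ops_power_a_pos:
  "v \<in> wt_le d \<Longrightarrow> ops_power (mode_series c a_pos) n k v \<in> wt_le (d - int k)"
proof (induction n arbitrary: k)
  case 0
  then show ?case by (auto simp: wt_le_zero)
next
  case (Suc n)
  have "mode_series c a_pos i (ops_power (mode_series c a_pos) n (k - i) v) \<in> wt_le (d - int k)"
    if "i \<le> k" for i
    using wt_le_a_pos[OF Suc.IH[OF Suc.prems], of c i "k - i"] that by (simp add: of_nat_diff)
  then show ?case by (auto intro!: wt_le_sum)
qed

lemma finite_ops_exp_a_pos:
  "finite {n. in_z_inverse (ops_exp (mode_series c a_pos)) n v \<noteq> 0}"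
proof -
  obtain d where d: "v \<in> wt_le d" using wt_le_exists by blast
  have "ops_exp (mode_series c a_pos) k v = 0" if "int k > d" for k
  proof (rule wt_le_negative)
    show "ops_exp (mode_series c a_pos) k v \<in> wt_le (d - int k)"
      unfolding ops_exp_def by (intro wt_le_sum wt_le_scaleL wt_le_ops_power_a_pos d)
  qed (use that in simp)
  then have "{n. in_z_inverse (ops_exp (mode_series c a_pos)) n v \<noteq> 0} \<subseteq> {- d..0}"
    by (force simp: in_z_inverse_def split: if_splits)
  then show ?thesis by (rule finite_subset) simp
qed


definition z_partial_alpha :: ser  \<comment> \<open>\<open>z\<^sup>\<partial>\<close>, so \<open>e\<^sup>\<beta> \<mapsto> z\<^bsup>(\<alpha>,\<beta>)\<^esup> e\<^sup>\<beta>\<close>\<close>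
  where "z_partial_alpha n v =
    (\<Sum>\<beta>\<in>Poly_Mapping.keys v.
       if pair_alpha \<beta> = n then Poly_Mapping.single \<beta> (Poly_Mapping.lookup v \<beta>) else 0)"

definition e_alpha_z_partial :: ser
  where "e_alpha_z_partial n v = Poly_Mapping.single alpha 1 * z_partial_alpha n v"

definition x_plus :: ser
  where "x_plus =
    in_z (ops_exp (mode_series (\<lambda>r. inverse q_half ^ r / qint r) a_neg)) \<odot>
    in_z_inverse (ops_exp (mode_series (\<lambda>r. - (inverse q_half ^ r / qint r)) a_pos)) \<odot>
    e_alpha_z_partial"

definition k_hat :: ser
  where "k_hat =
    in_z_inverse (ops_exp
      (mode_series (\<lambda>r. (q_var - inverse q_var) * (- (q_half ^ r) / (1 + q_var ^ (2 * r)))) a_pos))"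

definition x_hat :: ser
  where "x_hat = x_plus \<odot> k_hat"

end

theory Submission
  imports Defs
begin

text \<open>
  On \<open>p \<otimes> e\<^sup>\<beta>\<close> the operator \<open>x(z)\<close> first applies \<open>exp(\<Sum> c\<^sub>r a(r) z\<^sup>-\<^sup>r)\<close>, which is an algebra homomorphism
  because the \<open>a(r)\<close> are commuting derivations, and then multiplies by \<open>S(z) = exp(\<Sum> d\<^sub>r a(-r) z\<^sup>r)\<close> and
  by \<open>e\<^sup>\<alpha> z\<^sup>\<partial>\<close>. The coefficients satisfy \<open>c\<^sub>r d\<^sub>r [2r][r]/r = -2/r\<close>, so the homomorphism at \<open>z\<^sub>1\<close> sends \<open>S(z\<^sub>2)\<close>
  to \<open>(1 - z\<^sub>2/z\<^sub>1)\<^sup>2 S(z\<^sub>2)\<close>. With the factor \<open>z\<^sub>1\<^sup>2\<close> from \<open>z\<^sub>1\<^sup>\<partial> e\<^sup>\<alpha>\<close> the product of the two operators is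
  \<open>(z\<^sub>1 - z\<^sub>2)\<^sup>2\<close> times a normally ordered product, which vanishes at \<open>z\<^sub>1 = z\<^sub>2\<close>. Exponentials are handled
  through the recursion \<open>k E\<^sub>k = \<Sum>\<^sub>i i A\<^sub>i E\<^sub>k\<^sub>-\<^sub>i\<close> for the coefficients of \<open>E = exp A\<close>.
\<close>

subsection \<open>The contraction coefficient\<close>

text \<open>Characteristic zero: this permits division by r in the contraction coefficient and by k
  in the recursion for exponentials.\<close>

lemma of_nat_fld_eq_0_iff [simp]: "(of_nat n :: fld) = 0 \<longleftrightarrow> n = 0"
proof -
  have "(of_nat n :: fld) = Fract (of_nat n) 1"
    by (induction n) (auto simp: Zero_fract_def One_fract_def)
  then show ?thesis
    by (simp add: Zero_fract_def eq_fract)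
qed

lemma q_half_power: "q_half ^ n = Fract (monom 1 n) 1"
  by (induction n) (auto simp: q_half_def One_fract_def monom_0 monom_Suc one_pCons)

lemma q_half_nonzero: "q_half \<noteq> 0"
  by (simp add: q_half_def Zero_fract_def eq_fract)

text \<open>Degrees decide: a positive power of the indeterminate has positive degree, while 1 and
  -1 are constants. This lemma and the next keep the denominators below away from 0.\<close>

lemma q_half_power_neq_1: "n \<ge> 1 \<Longrightarrow> q_half ^ n \<noteq> 1"
  unfolding q_half_power One_fract_def
  by (auto simp: eq_fract dest!: arg_cong[where f = degree] simp: degree_monom_eq)

lemma q_half_power_neq_minus_1: "n \<ge> 1 \<Longrightarrow> q_half ^ n \<noteq> - 1"
  unfolding q_half_power One_fract_def
  by (auto simp: eq_fract dest!: arg_cong[where f = degree] simp: degree_monom_eq)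

text \<open>The coefficient from \<open>x_plus\<close> alone contributes -(1 + q^(-2r))/r, which
  exponentiates to (1 - w)(1 - q^(-2) w) with w = z_2/z_1. The one from \<open>k_hat\<close> adds
  -(1 - q^(-2r))/r and so turns the second factor into another 1 - w.\<close>

lemma contraction_coefficient:
  assumes "r \<ge> 1"
  shows "inverse q_half ^ r / qint r *
    ((- (inverse q_half ^ r / qint r) +
      (q_var - inverse q_var) * (- (q_half ^ r) / (1 + q_var ^ (2 * r)))) *
     (qint (2 * r) * qint r / of_nat r)) = - 2 / of_nat r"
proof -
  define h where "h = q_half ^ r"
  define w where "w = q_var - inverse q_var"
  have h0: "h \<noteq> 0" by (simp add: h_def q_half_nonzero)
  have h4: "h ^ 4 \<noteq> 1" "1 + h ^ 4 \<noteq> 0"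
    using q_half_power_neq_1[of "r * 4"] q_half_power_neq_minus_1[of "r * 4"] assms
    by (auto simp: h_def add_eq_0_iff simp flip: power_mult)
  have w0: "w \<noteq> 0"
    using q_half_power_neq_1[of 4] q_half_nonzero
    by (auto simp: w_def q_var_def field_simps simp flip: power_add power_mult)
  have 1: "q_var ^ (2 * r) = h ^ 4"
    by (simp add: q_var_def h_def mult.commute flip: power_mult)
  \<comment> \<open>In this form both q-integers become rational functions of h and w, with
    denominators known to be nonzero.\<close>
  have q: "qint m = ((q_var ^ m) ^ 2 - 1) / (q_var ^ m * w)" for m
  proof -
    have "x - inverse x = (x ^ 2 - 1) / x" if "x \<noteq> 0" for x :: fld
      using that by (simp add: field_simps power2_eq_square)
    moreover have "q_var ^ m \<noteq> 0"
      by (simp add: q_var_def q_half_nonzero)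
    ultimately show ?thesis
      by (simp add: qint_def w_def power_int_minus)
  qed
  have q1: "qint r = (h ^ 4 - 1) / (h ^ 2 * w)"
    unfolding q by (simp add: q_var_def h_def mult.commute flip: power_mult)
  have q2: "qint (2 * r) = (h ^ 8 - 1) / (h ^ 4 * w)"
    unfolding q by (simp add: q_var_def h_def mult.commute flip: power_mult)
  have h8: "h ^ 8 - 1 = (h ^ 4 - 1) * (1 + h ^ 4)"
    by (simp add: algebra_simps flip: power_add)
  have r0: "(of_nat r :: fld) \<noteq> 0" using assms by simp
  have q10: "h ^ 4 - 1 \<noteq> 0" using h4 by simp
  show ?thesis
    unfolding 1 q1 q2 h8 w_def[symmetric] h_def[symmetric] power_inverse
    using h0 h4 w0 r0 q10
    by (simp add: divide_simps) (simp add: algebra_simps power2_eq_square)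
qed

subsection \<open>Exponentials of commuting operators on the Fock space\<close>

definition const_fock :: "fld \<Rightarrow> fock"
  where "const_fock c = Poly_Mapping.single 0 c"

lemma const_fock_0 [simp]: "const_fock 0 = 0"
  by (simp add: const_fock_def)

lemma const_fock_1 [simp]: "const_fock 1 = 1"
  by (simp add: const_fock_def)

lemma const_fock_add: "const_fock (c + d) = const_fock c + const_fock d"
  by (simp add: const_fock_def single_add)

lemma const_fock_mult: "const_fock (c * d) = const_fock c * const_fock d"
  by (simp add: const_fock_def mult_single)

lemma const_fock_of_nat: "const_fock (of_nat n) = of_nat n"
  by (induction n) (simp_all add: const_fock_add)

lemma const_fock_uminus: "const_fock (- c) = - const_fock c"
  by (simp add: const_fock_def single_uminus)

lemma const_fock_inverse_mult_of_nat:
  "n > 0 \<Longrightarrow> const_fock (inverse (of_nat n)) * (of_nat n * p) = p"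
  unfolding mult.assoc[symmetric] const_fock_of_nat[symmetric] const_fock_mult[symmetric] by simp

text \<open>\<open>fock\<close> has no division, so the cancellation goes through the scalar 1/n of
  F.\<close>

lemma of_nat_mult_fock_cancel:
  fixes p p' :: fock
  assumes "n > 0" "of_nat n * p = of_nat n * p'"
  shows "p = p'"
  by (metis assms const_fock_inverse_mult_of_nat)

text \<open>Counterparts of \<open>ops_power\<close> and \<open>ops_exp\<close> on the factor K(1),
  where all the modes act; \<open>ops_exp_single\<close> carries the results back to L.\<close>

fun fock_power :: "(nat \<Rightarrow> fock \<Rightarrow> fock) \<Rightarrow> nat \<Rightarrow> nat \<Rightarrow> fock \<Rightarrow> fock" where
  "fock_power B 0 k p = (if k = 0 then p else 0)"
| "fock_power B (Suc n) k p = (\<Sum>i\<le>k. B i (fock_power B n (k - i) p))"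

definition fock_exp :: "(nat \<Rightarrow> fock \<Rightarrow> fock) \<Rightarrow> nat \<Rightarrow> fock \<Rightarrow> fock"
  where "fock_exp B k p = (\<Sum>n\<le>k. const_fock (1 / of_nat (fact n)) * fock_power B n k p)"

text \<open>Both sides run over the triangle i + j \<le> k; the next lemma sums the same triangle
  along the diagonals i + j = s.\<close>

lemma sum_triangle_swap:
  fixes f :: "nat \<Rightarrow> nat \<Rightarrow> 'a::comm_monoid_add"
  shows "(\<Sum>i\<le>k. \<Sum>j\<le>k - i. f i j) = (\<Sum>j\<le>k. \<Sum>i\<le>k - j. f i j)"
  by (simp add: sum.Sigma)
    (rule sum.reindex_bij_witness[where i = prod.swap and j = prod.swap]; auto)

lemma sum_triangle_diagonal:
  fixes f :: "nat \<Rightarrow> nat \<Rightarrow> 'a::comm_monoid_add"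
  shows "(\<Sum>i\<le>k. \<Sum>j\<le>k - i. f i j) = (\<Sum>s\<le>k. \<Sum>i\<le>s. f i (s - i))"
  by (simp add: sum.Sigma)
    (rule sum.reindex_bij_witness[where i = "\<lambda>(s, i). (i, s - i)" and j = "\<lambda>(i, j). (i + j, i)"];
     auto)

text \<open>Conditions on A(w) under which differentiation of powers follows the scalar rule: no
  constant term, F-linear coefficients, and coefficients that commute with each other.\<close>

locale commuting_family =
  fixes B :: "nat \<Rightarrow> fock \<Rightarrow> fock"
  assumes zeroth: "B 0 p = 0"
    and additive: "B r (p + p') = B r p + B r p'"
    and scale: "B r (const_fock c * p) = const_fock c * B r p"
    and commute: "B r (B s p) = B s (B r p)"
begin

lemma zero: "B r 0 = 0"
  using scale[of r 0 0] by simp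

lemma sum: "B r (sum f I) = (\<Sum>i\<in>I. B r (f i))"
  by (induction I rule: infinite_finite_induct) (auto simp: zero additive)

lemma mult_of_nat: "B r (of_nat n * p) = of_nat n * B r p"
  using scale[of r "of_nat n"] by (simp add: const_fock_of_nat)

text \<open>Without a constant term the n-th power starts in degree n, so the finite sum in
  \<open>fock_exp\<close> loses nothing of the exponential series.\<close>

lemma power_eq_0: "k < n \<Longrightarrow> fock_power B n k p = 0"
proof (induction n arbitrary: k)
  case (Suc n)
  have "B i (fock_power B n (k - i) p) = 0" if "i \<le> k" for i
  proof (cases "i = 0")
    case False
    with that Suc have "fock_power B n (k - i) p = 0" by auto
    then show ?thesis by (simp add: zero)
  qed (simp add: zeroth)
  then show ?case by simp
qed simp

text \<open>This is \<open>w (A\<^sup>n\<^sup>+\<^sup>1)' = (n + 1) (w A') A\<^sup>n\<close>, where the prime is \<open>d/dw\<close>.\<close>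

lemma power_deriv:
  "of_nat k * fock_power B (Suc n) k p =
     of_nat (Suc n) * (\<Sum>i\<le>k. of_nat i * B i (fock_power B n (k - i) p))"
proof (induction n arbitrary: k)
  case 0
  have "(\<Sum>i\<le>k. B i (if k - i = 0 then p else 0)) = B k p" for k
    by (subst sum.remove[of _ k]) (auto simp: zero intro!: sum.neutral)
  moreover have "(\<Sum>i\<le>k. of_nat i * B i (if k - i = 0 then p else 0)) = of_nat k * B k p"
    by (subst sum.remove[of _ k]) (auto simp: zero intro!: sum.neutral)
  ultimately show ?case by simp
next
  case (Suc n)
  let ?P = "\<lambda>n k. fock_power B n k p"
  have "of_nat k * ?P (Suc (Suc n)) k = (\<Sum>i\<le>k. of_nat k * B i (?P (Suc n) (k - i)))"
    by (simp only: fock_power.simps(2)[of B "Suc n"] sum_distrib_left)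
  \<comment> \<open>Leibniz rule: the degree k splits as i + (k - i), one share for
    \<open>B i\<close> and one for the remaining power, to which the induction hypothesis
    applies.\<close>
  also have "\<dots> = (\<Sum>i\<le>k. of_nat i * B i (?P (Suc n) (k - i)) +
      B i (of_nat (k - i) * ?P (Suc n) (k - i)))"
  proof (intro sum.cong refl)
    fix i assume "i \<in> {..k}"
    then have "(of_nat k :: fock) = of_nat i + of_nat (k - i)"
      by (simp flip: of_nat_add)
    then show "of_nat k * B i (?P (Suc n) (k - i)) =
        of_nat i * B i (?P (Suc n) (k - i)) + B i (of_nat (k - i) * ?P (Suc n) (k - i))"
      unfolding mult_of_nat by (simp only: distrib_right)
  qed
  also have "\<dots> = (\<Sum>i\<le>k. of_nat i * B i (?P (Suc n) (k - i))) +
      (\<Sum>i\<le>k. \<Sum>j\<le>k - i. of_nat (Suc n) * (of_nat j * B i (B j (?P n (k - i - j)))))"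
    unfolding Suc.IH by (simp only: sum.distrib mult_of_nat sum sum_distrib_left)
  also have "(\<Sum>i\<le>k. \<Sum>j\<le>k - i. of_nat (Suc n) * (of_nat j * B i (B j (?P n (k - i - j))))) =
      (\<Sum>j\<le>k. \<Sum>i\<le>k - j. of_nat (Suc n) * (of_nat j * B i (B j (?P n (k - i - j)))))"
    by (rule sum_triangle_swap)
  \<comment> \<open>Commutation moves the differentiated factor \<open>B j\<close> to the front; the
    inner sum over i is then the next power.\<close>
  also have "\<dots> = of_nat (Suc n) * (\<Sum>j\<le>k. of_nat j * B j (?P (Suc n) (k - j)))"
    by (simp only: fock_power.simps(2) sum sum_distrib_left, intro sum.cong refl)
      (subst commute, simp add: diff_commute add.commute)
  finally show ?case by (simp add: algebra_simps)
qed

lemma exp_0 [simp]: "fock_exp B 0 p = p"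
  by (simp add: fock_exp_def)

text \<open>This is w E' = (w A') E, obtained by dividing \<open>power_deriv\<close> by (n + 1)! and
  summing over n.\<close>

lemma exp_deriv: "of_nat k * fock_exp B k p = (\<Sum>i\<le>k. of_nat i * B i (fock_exp B (k - i) p))"
proof (cases k)
  case (Suc k')
  \<comment> \<open>Since k > 0, the term n = 0 of the exponential vanishes and the summation index
    can be shifted by one.\<close>
  have "of_nat k * fock_exp B k p =
      (\<Sum>n\<le>k'. const_fock (1 / of_nat (fact (Suc n))) * (of_nat k * fock_power B (Suc n) k p))"
    by (simp add: fock_exp_def Suc sum.atMost_Suc_shift sum_distrib_left mult_ac
        del: sum.atMost_Suc fock_power.simps(2) fact_Suc)
  also have "\<dots> = (\<Sum>n\<le>k'. \<Sum>i\<le>k. of_nat i * B i (const_fock (1 / of_nat (fact n)) *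
      fock_power B n (k - i) p))"
  proof (intro sum.cong refl)
    fix n
    have "of_nat (fact (Suc n)) = (of_nat (Suc n) * of_nat (fact n) :: fld)"
      by (simp only: fact_Suc of_nat_id of_nat_mult)
    then have "1 / of_nat (fact (Suc n)) * of_nat (Suc n) = (1 / of_nat (fact n) :: fld)"
      by (simp del: fact_Suc of_nat_Suc)
    then have "const_fock (1 / of_nat (fact (Suc n))) * of_nat (Suc n) =
        const_fock (1 / of_nat (fact n))"
      by (metis const_fock_mult const_fock_of_nat)
    then show "const_fock (1 / of_nat (fact (Suc n))) * (of_nat k * fock_power B (Suc n) k p) =
        (\<Sum>i\<le>k. of_nat i * B i (const_fock (1 / of_nat (fact n)) * fock_power B n (k - i) p))"
      unfolding power_deriv mult.assoc[symmetric]
      by (simp add: scale sum_distrib_left mult_ac)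
  qed
  also have "\<dots> = (\<Sum>i\<le>k. of_nat i * B i (\<Sum>n\<le>k'. const_fock (1 / of_nat (fact n)) *
      fock_power B n (k - i) p))"
    by (subst sum.swap) (simp add: sum sum_distrib_left)
  also have "\<dots> = (\<Sum>i\<le>k. of_nat i * B i (fock_exp B (k - i) p))"
  proof (intro sum.cong refl)
    fix i assume "i \<in> {..k}"
    \<comment> \<open>For i \<noteq> 0 the bound \<open>k'\<close> is at least k - i and the extra
      terms vanish by \<open>power_eq_0\<close>; the summand i = 0 carries the factor 0.\<close>
    have "fock_exp B (k - i) p =
        (\<Sum>n\<le>k'. const_fock (1 / of_nat (fact n)) * fock_power B n (k - i) p)" if "i \<noteq> 0"
      unfolding fock_exp_def using that Suc
      by (intro sum.mono_neutral_left) (auto simp: power_eq_0)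
    then show "of_nat i * B i (\<Sum>n\<le>k'. const_fock (1 / of_nat (fact n)) *
        fock_power B n (k - i) p) = of_nat i * B i (fock_exp B (k - i) p)"
      by (cases "i = 0") auto
  qed
  finally show ?thesis .
qed simp

text \<open>The summand i = 0 carries the factor 0, so in characteristic zero the recursion
  determines \<open>E k\<close> from the earlier coefficients. Identities between exponentials
  reduce to checking this recursion.\<close>

lemma exp_unique:
  assumes "E 0 = p" and "\<And>k. of_nat k * E k = (\<Sum>i\<le>k. of_nat i * B i (E (k - i)))"
  shows "fock_exp B k p = E k"
proof (induction k rule: less_induct)
  case (less k)
  show ?case
  proof (cases "k = 0")
    case False
    have "of_nat i * B i (fock_exp B (k - i) p) = of_nat i * B i (E (k - i))" for i
      using less[of "k - i"] False by (cases "i = 0") auto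
    then have "of_nat k * fock_exp B k p = of_nat k * E k"
      unfolding exp_deriv assms(2) by (intro sum.cong) auto
    with False show ?thesis by (metis of_nat_mult_fock_cancel neq0_conv)
  qed (simp add: assms(1))
qed

lemma exp_add: "fock_exp B k (p + p') = fock_exp B k p + fock_exp B k p'"
  by (rule exp_unique[where E = "\<lambda>k. fock_exp B k p + fock_exp B k p'"])
    (simp_all only: exp_0 exp_deriv distrib_left additive sum.distrib)

text \<open>Applying C to the exponential preserves the recursion and changes the initial value to
  \<open>C p\<close>. The cases used are scalars, other modes, and multiplication by a fixed
  element.\<close>

lemma exp_commute:
  assumes "\<And>p p'. C (p + p') = C p + C p'" and "\<And>r p. C (B r p) = B r (C p)"
  shows "fock_exp B k (C p) = C (fock_exp B k p)"
proof (rule exp_unique[where E = "\<lambda>k. C (fock_exp B k p)"])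
  interpret C: additive C by unfold_locales (rule assms)
  have n: "C (of_nat n * p) = of_nat n * C p" for n p
    by (induction n) (simp_all add: C.zero C.add algebra_simps)
  show "of_nat k * C (fock_exp B k p) = (\<Sum>i\<le>k. of_nat i * B i (C (fock_exp B (k - i) p)))" for k
    by (simp add: C.sum exp_deriv flip: n assms(2))
qed simp

lemma exp_zero: "fock_exp B k 0 = 0"
  using exp_add[of k 0 0] by (metis add_0 add_cancel_right_right)

lemma exp_sum: "fock_exp B k (sum f I) = (\<Sum>i\<in>I. fock_exp B k (f i))"
  by (induction I rule: infinite_finite_induct) (auto simp: exp_zero exp_add)

lemma exp_scale: "fock_exp B k (const_fock c * p) = const_fock c * fock_exp B k p"
  by (rule exp_commute) (simp_all add: scale distrib_left)

end

subsection \<open>Exponentials of the Heisenberg modes\<close>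

definition fock_mode :: "(nat \<Rightarrow> fld) \<Rightarrow> (nat \<Rightarrow> fock \<Rightarrow> fock) \<Rightarrow> nat \<Rightarrow> fock \<Rightarrow> fock"
  where "fock_mode c A r p = (if r = 0 then 0 else const_fock (c r) * A r p)"

lemma sum_atMost_eq_last:
  fixes f :: "nat \<Rightarrow> 'a::comm_monoid_add"
  assumes "\<And>i. i < k \<Longrightarrow> f i = 0"
  shows "sum f {..k} = f k"
  using assms by (simp flip: lessThan_Suc_atMost)

lemma partial_deriv_commute:
  "partial_deriv i (partial_deriv j p) = partial_deriv j (partial_deriv i p)"
proof (induction p rule: fock_induct)
  case (add m c p)
  have "m - Poly_Mapping.single i 1 - Poly_Mapping.single j 1 =
      m - Poly_Mapping.single j 1 - Poly_Mapping.single i 1"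
    by (intro poly_mapping_eqI) (simp add: lookup_minus)
  then have "partial_deriv i (partial_deriv j (Poly_Mapping.single m c)) =
      partial_deriv j (partial_deriv i (Poly_Mapping.single m c))"
    by (cases "i = j") (simp_all add: partial_deriv_single lookup_minus lookup_single mult_ac)
  with add show ?case
    by (simp add: partial_deriv_add)
qed (simp add: partial_deriv_zero)

lemma a_pos_zero: "a_pos r 0 = 0"
  by (simp add: a_pos_def partial_deriv_zero)

lemma a_pos_const_mult: "a_pos r (const_fock c * p) = const_fock c * a_pos r p"
  unfolding const_fock_def by (rule a_pos_scale)

lemma a_pos_const: "a_pos r (const_fock c) = 0"
  by (simp add: a_pos_def const_fock_def partial_deriv_single)

lemma a_pos_commute: "a_pos r (a_pos s p) = a_pos s (a_pos r p)"
proof -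
  have "a_pos r (a_pos s p) = const_fock (qint (2 * s) * qint s / of_nat s) *
      (const_fock (qint (2 * r) * qint r / of_nat r) *
        partial_deriv (r - 1) (partial_deriv (s - 1) p))" for r s
    by (subst (2) a_pos_def) (simp only: a_pos_scale, simp only: a_pos_def const_fock_def)
  moreover have "partial_deriv (r - 1) (partial_deriv (s - 1) p) =
      partial_deriv (s - 1) (partial_deriv (r - 1) p)"
    by (rule partial_deriv_commute)
  ultimately show ?thesis
    by (simp only: mult.left_commute)
qed

interpretation a_pos: commuting_family "fock_mode c a_pos" for c
  by unfold_locales
    (auto simp: fock_mode_def a_pos_add a_pos_zero a_pos_const_mult a_pos_commute distrib_left
      mult.left_commute)

interpretation a_neg: commuting_family "fock_mode c a_neg" for c
  by unfold_locales (auto simp: fock_mode_def a_neg_def algebra_simps)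

lemma fock_mode_a_pos_mult:
  "fock_mode c a_pos r (p * p') = fock_mode c a_pos r p * p' + p * fock_mode c a_pos r p'"
  by (simp add: fock_mode_def a_pos_mult algebra_simps)

text \<open>The exponential of a derivation is an algebra homomorphism: the Cauchy product on the
  right satisfies the recursion, by the Leibniz rule both for w d/dw and for the modes.\<close>

lemma exp_a_pos_mult:
  "fock_exp (fock_mode c a_pos) k (p * p') =
     (\<Sum>i\<le>k. fock_exp (fock_mode c a_pos) i p * fock_exp (fock_mode c a_pos) (k - i) p')"
proof (rule a_pos.exp_unique[where E = "\<lambda>k. \<Sum>i\<le>k. fock_exp (fock_mode c a_pos) i p *
    fock_exp (fock_mode c a_pos) (k - i) p'"])
  fix k
  let ?B = "fock_mode c a_pos"
  let ?E = "fock_exp ?B"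
  have "of_nat k * (\<Sum>i\<le>k. ?E i p * ?E (k - i) p') =
      (\<Sum>i\<le>k. (of_nat i * ?E i p) * ?E (k - i) p') + (\<Sum>i\<le>k. ?E i p * (of_nat (k - i) * ?E (k - i) p'))"
    unfolding sum_distrib_left sum.distrib[symmetric]
  proof (intro sum.cong refl)
    fix i assume "i \<in> {..k}"
    then have "(of_nat k :: fock) = of_nat i + of_nat (k - i)"
      by (simp flip: of_nat_add)
    then show "of_nat k * (?E i p * ?E (k - i) p') =
        of_nat i * ?E i p * ?E (k - i) p' + ?E i p * (of_nat (k - i) * ?E (k - i) p')"
      by (simp only: distrib_right distrib_left mult_ac)
  qed
  also have "(\<Sum>i\<le>k. (of_nat i * ?E i p) * ?E (k - i) p') =
      (\<Sum>s\<le>k. \<Sum>i\<le>s. of_nat i * (?B i (?E (s - i) p) * ?E (k - i - (s - i)) p'))"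
    by (simp add: a_pos.exp_deriv sum_distrib_right mult.assoc)
  also have "\<dots> = (\<Sum>i\<le>k. \<Sum>j\<le>k - i. of_nat i * (?B i (?E j p) * ?E (k - i - j) p'))"
    by (rule sum_triangle_diagonal[symmetric])
  also have "(\<Sum>i\<le>k. ?E i p * (of_nat (k - i) * ?E (k - i) p')) =
      (\<Sum>j\<le>k. \<Sum>i\<le>k - j. of_nat i * (?E j p * ?B i (?E (k - i - j) p')))"
    by (simp add: a_pos.exp_deriv sum_distrib_left mult.left_commute diff_commute add.commute
        del: of_nat_diff)
  also have "\<dots> = (\<Sum>i\<le>k. \<Sum>j\<le>k - i. of_nat i * (?E j p * ?B i (?E (k - i - j) p')))"
    by (rule sum_triangle_swap)
  also have "(\<Sum>i\<le>k. \<Sum>j\<le>k - i. of_nat i * (?B i (?E j p) * ?E (k - i - j) p')) + \<dots> =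
      (\<Sum>i\<le>k. of_nat i * ?B i (\<Sum>j\<le>k - i. ?E j p * ?E (k - i - j) p'))"
    by (simp only: a_pos.sum fock_mode_a_pos_mult sum.distrib sum_distrib_left distrib_left)
  finally show "of_nat k * (\<Sum>i\<le>k. ?E i p * ?E (k - i) p') =
      (\<Sum>i\<le>k. of_nat i * ?B i (\<Sum>j\<le>k - i. ?E j p * ?E (k - i - j) p'))" .
qed simp

text \<open>For commuting modes exp A exp B = exp (A + B). This merges the annihilation factor of
  \<open>x_plus\<close> with \<open>k_hat\<close>.\<close>

lemma exp_a_pos_compose:
  "(\<Sum>i\<le>k. fock_exp (fock_mode c a_pos) i (fock_exp (fock_mode d a_pos) (k - i) p)) =
     fock_exp (fock_mode (\<lambda>r. c r + d r) a_pos) k p"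
proof (rule a_pos.exp_unique[where E = "\<lambda>k. \<Sum>i\<le>k. fock_exp (fock_mode c a_pos) i
    (fock_exp (fock_mode d a_pos) (k - i) p)", symmetric])
  fix k
  let ?B = "fock_mode c a_pos" and ?C = "fock_mode d a_pos"
  let ?E = "fock_exp ?B" and ?F = "fock_exp ?C"
  \<comment> \<open>Needed to bring the modes with coefficients d out of the exponential with
    coefficients c.\<close>
  have comm: "?E i (?C j q) = ?C j (?E i q)" for i j q
    by (rule a_pos.exp_commute)
      (auto simp: fock_mode_def a_pos_add a_pos_zero a_pos_const_mult a_pos_commute distrib_left
        mult.left_commute)
  have nat: "?E i (of_nat n * q) = of_nat n * ?E i q" for i n q
    using a_pos.exp_scale[of c i "of_nat n"] by (simp add: const_fock_of_nat)
  have "of_nat k * (\<Sum>i\<le>k. ?E i (?F (k - i) p)) =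
      (\<Sum>i\<le>k. of_nat i * ?E i (?F (k - i) p)) + (\<Sum>i\<le>k. ?E i (of_nat (k - i) * ?F (k - i) p))"
    unfolding sum_distrib_left sum.distrib[symmetric] nat
  proof (intro sum.cong refl)
    fix i assume "i \<in> {..k}"
    then have "(of_nat k :: fock) = of_nat i + of_nat (k - i)"
      by (simp flip: of_nat_add)
    then show "of_nat k * ?E i (?F (k - i) p) =
        of_nat i * ?E i (?F (k - i) p) + of_nat (k - i) * ?E i (?F (k - i) p)"
      by (simp only: distrib_right)
  qed
  also have "(\<Sum>i\<le>k. of_nat i * ?E i (?F (k - i) p)) =
      (\<Sum>s\<le>k. \<Sum>i\<le>s. of_nat i * ?B i (?E (s - i) (?F (k - i - (s - i)) p)))"
    by (simp add: a_pos.exp_deriv)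
  also have "\<dots> = (\<Sum>i\<le>k. \<Sum>j\<le>k - i. of_nat i * ?B i (?E j (?F (k - i - j) p)))"
    by (rule sum_triangle_diagonal[symmetric])
  also have "(\<Sum>i\<le>k. ?E i (of_nat (k - i) * ?F (k - i) p)) =
      (\<Sum>j\<le>k. \<Sum>i\<le>k - j. of_nat i * ?C i (?E j (?F (k - i - j) p)))"
    by (simp add: a_pos.exp_deriv a_pos.exp_sum nat comm diff_commute add.commute
        del: of_nat_diff)
  also have "\<dots> = (\<Sum>i\<le>k. \<Sum>j\<le>k - i. of_nat i * ?C i (?E j (?F (k - i - j) p)))"
    by (rule sum_triangle_swap)
  also have "(\<Sum>i\<le>k. \<Sum>j\<le>k - i. of_nat i * ?B i (?E j (?F (k - i - j) p))) + \<dots> =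
      (\<Sum>i\<le>k. of_nat i * fock_mode (\<lambda>r. c r + d r) a_pos i (\<Sum>j\<le>k - i. ?E j (?F (k - i - j) p)))"
  proof -
    have "fock_mode (\<lambda>r. c r + d r) a_pos i q = ?B i q + ?C i q" for i q
      by (simp add: fock_mode_def const_fock_add distrib_right)
    then show ?thesis
      by (simp only: a_pos.sum sum.distrib sum_distrib_left distrib_left)
  qed
  finally show "of_nat k * (\<Sum>i\<le>k. ?E i (?F (k - i) p)) =
      (\<Sum>i\<le>k. of_nat i * fock_mode (\<lambda>r. c r + d r) a_pos i (\<Sum>j\<le>k - i. ?E j (?F (k - i - j) p)))" .
qed simp

lemma exp_a_pos_one: "fock_exp (fock_mode c a_pos) k 1 = (if k = 0 then 1 else 0)"
proof (rule a_pos.exp_unique[where E = "\<lambda>k. if k = 0 then 1 else 0"])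
  have "fock_mode c a_pos i (if P then 1 else 0) = 0" for i P
    using a_pos_const[of i 1] by (simp add: fock_mode_def a_pos_zero)
  then show "of_nat k * (if k = 0 then 1 else 0) =
      (\<Sum>i\<le>k. of_nat i * fock_mode c a_pos i (if k - i = 0 then 1 else 0))" for k
    by simp
qed simp

text \<open>Only a(r) acts nontrivially on the generator a(-r), and it leaves a constant that every
  further mode kills, so the series stops after one correction term.\<close>

lemma exp_a_pos_gen:
  assumes "r \<ge> 1"
  shows "fock_exp (fock_mode c a_pos) k (gen r) =
    (if k = 0 then gen r
     else if k = r then const_fock (c r * (qint (2 * r) * qint r / of_nat r)) else 0)"
proof (rule a_pos.exp_unique)
  let ?E = "\<lambda>k. if k = 0 then gen r
     else if k = r then const_fock (c r * (qint (2 * r) * qint r / of_nat r)) else 0"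
  fix k
  \<comment> \<open>For i < k the coefficient in degree k - i > 0 is a constant, hence
    annihilated.\<close>
  have "of_nat i * fock_mode c a_pos i (?E (k - i)) = 0" if "i < k" for i
    using that by (auto simp: fock_mode_def a_pos_const a_pos_zero)
  then have "(\<Sum>i\<le>k. of_nat i * fock_mode c a_pos i (?E (k - i))) =
      of_nat k * fock_mode c a_pos k (gen r)"
    by (rule sum_atMost_eq_last[THEN trans]) simp_all
  also have "\<dots> = of_nat k * ?E k"
    using assms by (auto simp: fock_mode_def a_pos_gen simp flip: const_fock_def const_fock_mult)
  finally show "of_nat k * ?E k = (\<Sum>i\<le>k. of_nat i * fock_mode c a_pos i (?E (k - i)))" ..
qed simp

lemma exp_a_pos_gen_mult:
  assumes "r \<ge> 1"
  shows "fock_exp (fock_mode c a_pos) k (gen r * p) = gen r * fock_exp (fock_mode c a_pos) k p +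
    (if r \<le> k then const_fock (c r * (qint (2 * r) * qint r / of_nat r)) *
       fock_exp (fock_mode c a_pos) (k - r) p else 0)"
proof -
  let ?K = "const_fock (c r * (qint (2 * r) * qint r / of_nat r))"
  let ?E = "fock_exp (fock_mode c a_pos)"
  have "?E k (gen r * p) = (\<Sum>i\<le>k. (if i = 0 then gen r * ?E k p else 0) +
      (if i = r then ?K * ?E (k - r) p else 0))"
    unfolding exp_a_pos_mult exp_a_pos_gen[OF assms] using assms by (intro sum.cong) auto
  then show ?thesis
    by (simp add: sum.distrib)
qed

section \<open>Contraction of annihilation and creation exponentials\<close>

definition creation_coeff :: "(nat \<Rightarrow> fld) \<Rightarrow> nat \<Rightarrow> fock"
  where "creation_coeff d n = fock_exp (fock_mode d a_neg) n 1"

text \<open>Right multiplication by p commutes with every a(-r), so the action on p is determined by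
  the action on 1.\<close>

lemma exp_a_neg: "fock_exp (fock_mode d a_neg) n p = creation_coeff d n * p"
  using a_neg.exp_commute[of "\<lambda>x. x * p" d n 1]
  by (simp add: creation_coeff_def distrib_right fock_mode_def a_neg_def mult.assoc)

lemma creation_coeff_0: "creation_coeff d 0 = 1"
  by (simp add: creation_coeff_def)

lemma creation_coeff_deriv:
  "of_nat n * creation_coeff d n =
     (\<Sum>i=1..n. of_nat i * (const_fock (d i) * (gen i * creation_coeff d (n - i))))"
proof -
  have "of_nat n * creation_coeff d n =
      (\<Sum>i\<le>n. of_nat i * fock_mode d a_neg i (creation_coeff d (n - i)))"
    unfolding creation_coeff_def by (rule a_neg.exp_deriv)
  also have "\<dots> = (\<Sum>i=1..n. of_nat i * fock_mode d a_neg i (creation_coeff d (n - i)))"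
    by (rule sum.mono_neutral_right) (auto simp: not_le)
  finally show ?thesis
    by (simp add: fock_mode_def a_neg_def)
qed

definition one_minus_sq_coeff :: "nat \<Rightarrow> fock"  \<comment> \<open>coefficients of \<open>(1 - w)\<^sup>2\<close>\<close>
  where "one_minus_sq_coeff k = (if k = 0 then 1 else if k = 1 then - 2 else if k = 2 then 1 else 0)"

text \<open>For g = (1 - w)^2 this is w g' = -2 (w/(1 - w)) g, the recursion for exp(-2 \<Sum>
  w^r/r).\<close>

lemma one_minus_sq_coeff_deriv:
  "of_nat k * one_minus_sq_coeff k = - 2 * (\<Sum>i=1..k. one_minus_sq_coeff (k - i))"
proof -
  have eq: "(\<Sum>i=1..k. one_minus_sq_coeff (k - i)) = (\<Sum>i<k. one_minus_sq_coeff i)"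
    by (rule sum.reindex_bij_witness[where i = "\<lambda>i. k - i" and j = "\<lambda>i. k - i"]) auto
  have 0: "(\<Sum>i<Suc (Suc (Suc n)). one_minus_sq_coeff i) = 0" for n
    by (induction n) (simp_all add: one_minus_sq_coeff_def)
  consider "k = 0" | "k = 1" | "k = 2" | n where "k = Suc (Suc (Suc n))"
    by (metis One_nat_def Suc_1 not0_implies_Suc)
  then show ?thesis
    unfolding eq
    by cases (simp_all only: 0, simp_all add: one_minus_sq_coeff_def numeral_2_eq_2)
qed

text \<open>Induction on n through the recursion for S: moving the exponential past a generator
  leaves an uncontracted term and a contraction. The former sum to n - k times the result, the
  latter to k times it.\<close>

lemma exp_a_pos_creation_coeff:
  assumes "\<And>r. r \<ge> 1 \<Longrightarrow> d r * (c r * (qint (2 * r) * qint r / of_nat r)) = - 2 / of_nat r"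
  shows "fock_exp (fock_mode c a_pos) k (creation_coeff d n) =
    (if k \<le> n then one_minus_sq_coeff k * creation_coeff d (n - k) else 0)"
proof (induction n arbitrary: k rule: less_induct)
  case (less n)
  let ?E = "fock_exp (fock_mode c a_pos)" and ?S = "creation_coeff d" and ?g = one_minus_sq_coeff
  let ?K = "\<lambda>r. const_fock (c r * (qint (2 * r) * qint r / of_nat r))"
  show ?case
  proof (cases "n = 0")
    case True
    then show ?thesis
      by (simp add: creation_coeff_0 exp_a_pos_one one_minus_sq_coeff_def)
  next
    case False
    have nat: "?E k (of_nat n * q) = of_nat n * ?E k q" for n q
      using a_pos.exp_scale[of c k "of_nat n"] by (simp add: const_fock_of_nat)
    \<comment> \<open>The factor r from the recursion cancels the 1/r of the contraction, leaving a
      constant independent of r.\<close>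
    have contr: "of_nat r * (const_fock (d r) * (?K r * q)) = - 2 * q" if "r \<ge> 1" for r q
    proof -
      have "of_nat r * (const_fock (d r) * (?K r * q)) =
          const_fock (of_nat r * (d r * (c r * (qint (2 * r) * qint r / of_nat r)))) * q"
        by (simp only: const_fock_mult const_fock_of_nat mult.assoc)
      also have "of_nat r * (d r * (c r * (qint (2 * r) * qint r / of_nat r))) = - of_nat 2"
        unfolding assms[OF that] using that by simp
      finally show ?thesis
        by (simp only: const_fock_uminus const_fock_of_nat) simp
    qed
    have "of_nat n * ?E k (?S n) =
        (\<Sum>i=1..n. of_nat i * (const_fock (d i) * ?E k (gen i * ?S (n - i))))"
      unfolding nat[symmetric] creation_coeff_deriv a_pos.exp_sum
      unfolding nat a_pos.exp_scale ..
    also have "\<dots> = (\<Sum>i=1..n.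
        (if k \<le> n - i then ?g k * (of_nat i * (const_fock (d i) * (gen i * ?S (n - k - i)))) else 0) +
        (if i \<le> k \<and> k \<le> n then - 2 * ?g (k - i) * ?S (n - k) else 0))"
    proof (intro sum.cong refl)
      fix i assume i: "i \<in> {1..n}"
      then have "n - i < n" by simp
      note IH = less[OF this]
      show "of_nat i * (const_fock (d i) * ?E k (gen i * ?S (n - i))) =
        (if k \<le> n - i then ?g k * (of_nat i * (const_fock (d i) * (gen i * ?S (n - k - i)))) else 0) +
        (if i \<le> k \<and> k \<le> n then - 2 * ?g (k - i) * ?S (n - k) else 0)"
      proof -
        have 1: "n - i - (k - i) = n - k" if "i \<le> k" using that by simp
        have 2: "n - i - k = n - k - i" by simp
        have 3: "k - i \<le> n - i \<longleftrightarrow> k \<le> n" if "i \<le> k" using i that by auto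
        have "?E k (gen i * ?S (n - i)) =
            (if k \<le> n - i then gen i * (?g k * ?S (n - k - i)) else 0) +
            (if i \<le> k \<and> k \<le> n then ?K i * (?g (k - i) * ?S (n - k)) else 0)"
          using i 1 3 by (auto simp: exp_a_pos_gen_mult IH 2 add.commute)
        moreover have "of_nat i * (const_fock (d i) * (?K i * (?g (k - i) * ?S (n - k)))) =
            - 2 * ?g (k - i) * ?S (n - k)"
          using i by (subst contr) auto
        ultimately show ?thesis
          by (simp only: distrib_left if_distrib[of "(*) x" for x] mult_zero_right)
            (simp only: mult.left_commute)
      qed
    qed
    also have "\<dots> = of_nat n * (if k \<le> n then ?g k * ?S (n - k) else 0)"
    proof (cases "k \<le> n")
      case True
      have "(\<Sum>i=1..n. if k \<le> n - i
            then ?g k * (of_nat i * (const_fock (d i) * (gen i * ?S (n - k - i)))) else 0) =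
          (\<Sum>i=1..n-k. ?g k * (of_nat i * (const_fock (d i) * (gen i * ?S (n - k - i)))))"
        using True by (intro sum.mono_neutral_cong_right) auto
      also have "\<dots> = ?g k * (of_nat (n - k) * ?S (n - k))"
        by (simp add: creation_coeff_deriv sum_distrib_left)
      finally have 1: "(\<Sum>i=1..n. if k \<le> n - i
            then ?g k * (of_nat i * (const_fock (d i) * (gen i * ?S (n - k - i)))) else 0) =
          ?g k * (of_nat (n - k) * ?S (n - k))" .
      have "(\<Sum>i=1..n. if i \<le> k \<and> k \<le> n then - 2 * ?g (k - i) * ?S (n - k) else 0) =
          (\<Sum>i=1..k. - 2 * ?g (k - i) * ?S (n - k))"
        using True by (intro sum.mono_neutral_cong_right) auto
      also have "\<dots> = of_nat k * ?g k * ?S (n - k)"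
        unfolding one_minus_sq_coeff_deriv sum_distrib_left sum_distrib_right ..
      finally have 2: "(\<Sum>i=1..n. if i \<le> k \<and> k \<le> n then - 2 * ?g (k - i) * ?S (n - k) else 0) =
          of_nat k * ?g k * ?S (n - k)" .
      \<comment> \<open>The two partial sums together restore the factor n, which is then
        cancelled.\<close>
      have "(of_nat n :: fock) = of_nat (n - k) + of_nat k"
        using True by (simp flip: of_nat_add)
      then show ?thesis
        unfolding sum.distrib 1 2 using True by (simp add: algebra_simps)
    next
      case False
      then show ?thesis by (auto intro!: sum.neutral)
    qed
    finally show ?thesis
      by (rule of_nat_mult_fock_cancel[rotated]) (use False in simp)
  qed
qed

subsection \<open>Operator-valued series on \<open>L\<close>\<close>

lemma single_sum: "Poly_Mapping.single \<beta> (sum f I) = (\<Sum>i\<in>I. Poly_Mapping.single \<beta> (f i))"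
  by (induction I rule: infinite_finite_induct) (auto simp: single_add)

lemma single_eq_0_iff [simp]: "Poly_Mapping.single \<beta> p = 0 \<longleftrightarrow> p = 0"
  by (metis lookup_single_eq lookup_zero single_zero)

lemma spc_induct [case_names zero add]:
  fixes v :: spc
  assumes "P 0" and "\<And>\<beta> p v. P v \<Longrightarrow> P (Poly_Mapping.single \<beta> p + v)"
  shows "P v"
proof (induction v rule: update_induct)
  case (update f a b)
  have "Poly_Mapping.update a b f = Poly_Mapping.single a b + f"
    using update by (intro poly_mapping_eqI)
      (auto simp: lookup_add lookup_single lookup_update when_def in_keys_iff)
  with assms(2) update show ?case by simp
qed (fact assms(1))

lemma lookup_scaleL:
  "Poly_Mapping.lookup (scaleL c v) \<beta> = const_fock c * Poly_Mapping.lookup v \<beta>"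
  by (simp add: scaleL_def lookup_scalar_mult const_fock_def)

lemma scaleL_single: "scaleL c (Poly_Mapping.single \<beta> p) = Poly_Mapping.single \<beta> (const_fock c * p)"
  by (simp add: scaleL_def const_fock_def mult_single)

lemma vector_space_scaleL: "vector_space scaleL"
  by unfold_locales
    (auto intro!: poly_mapping_eqI simp: lookup_scaleL lookup_add const_fock_add const_fock_mult
      algebra_simps)

section \<open>F-linear operators on L\<close>

abbreviation linearL :: "(spc \<Rightarrow> spc) \<Rightarrow> bool"
  where "linearL \<equiv> Vector_Spaces.linear scaleL scaleL"

lemma linearL_iff:
  "linearL f \<longleftrightarrow> (\<forall>u v. f (u + v) = f u + f v) \<and> (\<forall>c v. f (scaleL c v) = scaleL c (f v))"
  by (simp add: Vector_Spaces.linear_iff vector_space_scaleL)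

lemma linearL_add: "linearL f \<Longrightarrow> f (u + v) = f u + f v"
  by (simp add: linearL_iff)

lemma linearL_scaleL: "linearL f \<Longrightarrow> f (scaleL c v) = scaleL c (f v)"
  by (simp add: linearL_iff)

lemma scaleL_add: "scaleL c (u + v) = scaleL c u + scaleL c v"
  by (simp add: scaleL_def distrib_left)

lemma scaleL_commute: "scaleL c (scaleL d v) = scaleL d (scaleL c v)"
  by (simp add: scaleL_def mult.left_commute)

lemma scaleL_zero: "scaleL c 0 = 0"
  by (simp add: scaleL_def)

lemma scaleL_sum: "scaleL c (sum f I) = (\<Sum>i\<in>I. scaleL c (f i))"
  by (simp add: scaleL_def sum_distrib_left)

lemma linearL_zero: "linearL f \<Longrightarrow> f 0 = 0"
  using linearL_scaleL[of f 0 0] by (simp add: scaleL_def)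

lemma linearL_const_zero: "linearL (\<lambda>v. 0)"
  by (simp add: linearL_iff scaleL_zero)

lemma linearL_fun_sum: "(\<And>i. linearL (f i)) \<Longrightarrow> linearL (\<lambda>v. \<Sum>i\<in>I. f i v)"
  by (simp add: linearL_iff sum.distrib scaleL_sum)

lemma linearL_fun_scaleL: "linearL f \<Longrightarrow> linearL (\<lambda>v. scaleL c (f v))"
  by (simp add: linearL_iff scaleL_add scaleL_commute)

lemma linearL_compose: "linearL f \<Longrightarrow> linearL g \<Longrightarrow> linearL (\<lambda>v. f (g v))"
  by (simp add: linearL_iff)

lemma linearL_mode_series:
  assumes "\<And>r p p'. T r (p + p') = T r p + T r p'"
    and "\<And>r c p. T r (const_fock c * p) = const_fock c * T r p"
  shows "linearL (mode_series c T r)"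
proof -
  have T0: "T r 0 = 0" for r
    using assms(2)[of r 0 0] by simp
  have L: "Poly_Mapping.lookup (on_fock (T r) v) \<beta> = T r (Poly_Mapping.lookup v \<beta>)" for v \<beta>
    by (simp add: on_fock_def map.rep_eq when_def T0)
  have "linearL (on_fock (T r))"
    unfolding linearL_iff
    by (auto intro!: poly_mapping_eqI simp: L lookup_add lookup_scaleL assms)
  then show ?thesis
    unfolding mode_series_def by (cases "r = 0") (simp_all add: linearL_const_zero linearL_fun_scaleL)
qed

lemma linearL_ops_power:
  assumes "\<And>r. linearL (A r)"
  shows "linearL (ops_power A n k)"
proof (induction n arbitrary: k)
  case 0
  show ?case by (auto simp: linearL_iff scaleL_zero)
next
  case (Suc n)
  show ?case
    by (simp only: ops_power.simps(2)[abs_def]) (intro linearL_fun_sum linearL_compose[OF assms] Suc)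
qed

lemma linearL_ops_exp:
  assumes "\<And>r. linearL (A r)"
  shows "linearL (ops_exp A k)"
  unfolding ops_exp_def[abs_def]
  by (intro linearL_fun_sum linearL_fun_scaleL linearL_ops_power assms)

lemma linearL_in_z: "(\<And>k. linearL (A k)) \<Longrightarrow> linearL (in_z A n)"
  unfolding in_z_def[abs_def] by (cases "n \<ge> 0") (simp_all add: linearL_const_zero)

lemma linearL_in_z_inverse: "(\<And>k. linearL (A k)) \<Longrightarrow> linearL (in_z_inverse A n)"
  unfolding in_z_inverse_def[abs_def] by (cases "n \<le> 0") (simp_all add: linearL_const_zero)

lemma linearL_exp_a_pos: "linearL (ops_exp (mode_series c a_pos) k)"
  by (intro linearL_ops_exp linearL_mode_series a_pos_add a_pos_const_mult)

lemma linearL_exp_a_neg: "linearL (ops_exp (mode_series c a_neg) k)"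
  by (intro linearL_ops_exp linearL_mode_series) (simp_all add: a_neg_def algebra_simps)

section \<open>Linearity and finiteness of products of series\<close>

lemma prod1_apply: "(A \<odot> B) k v = Sum_any (\<lambda>m. A m (B (k - m) v))"
  by (simp add: prod1_def specialize_def prod2_def)

text \<open>\<open>Sum_any\<close> is additive only on families of finite support; here the support
  is controlled by the nonzero coefficients of the right factor.\<close>

lemma finite_prod1_terms:
  fixes A B :: ser
  assumes "\<And>n. linearL (A n)" and "finite {n. B n v \<noteq> 0}"
  shows "finite {m. A m (B (k - m) v) \<noteq> 0}"
proof (rule finite_subset)
  show "{m. A m (B (k - m) v) \<noteq> 0} \<subseteq> (\<lambda>n. k - n) ` {n. B n v \<noteq> 0}"
  proof
    fix m assume "m \<in> {m. A m (B (k - m) v) \<noteq> 0}"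
    then have "k - m \<in> {n. B n v \<noteq> 0}"
      using linearL_zero[OF assms(1)] by auto
    then show "m \<in> (\<lambda>n. k - n) ` {n. B n v \<noteq> 0}"
      by (rule rev_image_eqI) simp
  qed
qed (use assms in simp)

lemma linearL_prod1:
  assumes A: "\<And>n. linearL (A n)" and B: "\<And>n. linearL (B n)"
    and fin: "\<And>v. finite {n. B n v \<noteq> 0}"
  shows "linearL ((A \<odot> B) k)"
  unfolding linearL_iff prod1_apply
proof (intro conjI allI)
  note fin' = finite_prod1_terms[where A = A and B = B, OF A fin]
  show "Sum_any (\<lambda>m. A m (B (k - m) (u + v))) =
      Sum_any (\<lambda>m. A m (B (k - m) u)) + Sum_any (\<lambda>m. A m (B (k - m) v))" for u v
    by (simp add: linearL_add[OF A] linearL_add[OF B] Sum_any.distrib[OF fin' fin'])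
  show "Sum_any (\<lambda>m. A m (B (k - m) (scaleL c v))) = scaleL c (Sum_any (\<lambda>m. A m (B (k - m) v)))" for c v
    unfolding linearL_scaleL[OF B] linearL_scaleL[OF A]
    unfolding scaleL_def by (rule Sum_any_right_distrib[symmetric]) (rule fin')
qed

text \<open>Allows nesting: the right factor of \<open>x_plus\<close> is itself a product and must
  again have finitely many nonzero coefficients on each vector.\<close>

lemma finite_prod1:
  assumes "\<And>v. finite {n. A n v \<noteq> 0}" and "\<And>n. linearL (A n)" and "\<And>v. finite {n. B n v \<noteq> 0}"
  shows "finite {n. (A \<odot> B) n v \<noteq> 0}"
proof (rule finite_subset)
  let ?S = "\<Union>n\<in>{n. B n v \<noteq> 0}. (\<lambda>m. m + n) ` {m. A m (B n v) \<noteq> 0}"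
  show "finite ?S"
    using assms by auto
  show "{n. (A \<odot> B) n v \<noteq> 0} \<subseteq> ?S"
  proof
    fix k assume "k \<in> {n. (A \<odot> B) n v \<noteq> 0}"
    then obtain m where m: "A m (B (k - m) v) \<noteq> 0"
      unfolding prod1_apply by (auto elim: Sum_any.not_neutral_obtains_not_neutral)
    moreover from m have "B (k - m) v \<noteq> 0"
      using linearL_zero[OF assms(2)] by auto
    ultimately show "k \<in> ?S"
      by (auto intro!: exI[of _ "k - m"] rev_image_eqI[of m])
  qed
qed

text \<open>The pairing of \<alpha> with n \<lambda> is n, so exactly the component of weight n
  occurs at z^n, and e^\<alpha> shifts it by 2.\<close>

lemma e_alpha_z_partial_eq:
  "e_alpha_z_partial n v = Poly_Mapping.single (n + 2) (Poly_Mapping.lookup v n)"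
proof -
  have "z_partial_alpha n v = (\<Sum>\<beta>\<in>Poly_Mapping.keys v.
      if \<beta> = n then Poly_Mapping.single n (Poly_Mapping.lookup v n) else 0)"
    unfolding z_partial_alpha_def by (intro sum.cong) (auto simp: pair_alpha_def alpha_def)
  also have "\<dots> = Poly_Mapping.single n (Poly_Mapping.lookup v n)"
    by (simp add: in_keys_iff)
  finally show ?thesis
    by (simp add: e_alpha_z_partial_def alpha_def mult_single add.commute)
qed

lemma linearL_e_alpha_z_partial: "linearL (e_alpha_z_partial n)"
  unfolding linearL_iff e_alpha_z_partial_eq
  by (simp add: lookup_add single_add lookup_scaleL scaleL_single)

lemma finite_e_alpha_z_partial: "finite {n. e_alpha_z_partial n v \<noteq> 0}"
  by (rule finite_subset[of _ "Poly_Mapping.keys v"])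
    (auto simp: e_alpha_z_partial_eq in_keys_iff)

lemma linearL_x_plus: "linearL (x_plus n)"
  unfolding x_plus_def
  by (intro linearL_prod1 linearL_in_z linearL_in_z_inverse linearL_exp_a_pos linearL_exp_a_neg
      linearL_e_alpha_z_partial finite_e_alpha_z_partial finite_prod1 finite_ops_exp_a_pos)

lemma linearL_x_hat: "linearL (x_hat n)"
  unfolding x_hat_def k_hat_def
  by (intro linearL_prod1 linearL_in_z_inverse linearL_exp_a_pos linearL_x_plus finite_ops_exp_a_pos)

section \<open>Reduction to the Fock space and weight bounds\<close>

lemma mode_series_single:
  assumes "\<And>r. A r 0 = 0"
  shows "mode_series c A r (Poly_Mapping.single \<beta> p) = Poly_Mapping.single \<beta> (fock_mode c A r p)"
proof -
  have "on_fock (A r) (Poly_Mapping.single \<beta> p) = Poly_Mapping.single \<beta> (A r p)"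
    by (rule poly_mapping_eqI) (auto simp: on_fock_def map.rep_eq lookup_single when_def assms)
  then show ?thesis
    by (simp add: mode_series_def fock_mode_def scaleL_single)
qed

lemma ops_power_single:
  assumes "\<And>r. A r 0 = 0"
  shows "ops_power (mode_series c A) n k (Poly_Mapping.single \<beta> p) =
    Poly_Mapping.single \<beta> (fock_power (fock_mode c A) n k p)"
  by (induction n arbitrary: k) (simp_all add: mode_series_single[where A = A, OF assms] single_sum)

lemma ops_exp_single:
  assumes "\<And>r. A r 0 = 0"
  shows "ops_exp (mode_series c A) k (Poly_Mapping.single \<beta> p) =
    Poly_Mapping.single \<beta> (fock_exp (fock_mode c A) k p)"
  by (simp add: ops_exp_def fock_exp_def ops_power_single[where A = A, OF assms] scaleL_single single_sum)

lemma a_neg_zero: "a_neg r 0 = 0"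
  by (simp add: a_neg_def)

text \<open>Embedding p as p \<otimes> e^0 makes the weight estimates on L available for
  K(1).\<close>

definition fock_wt_le :: "int \<Rightarrow> fock set"
  where "fock_wt_le d = {p. Poly_Mapping.single 0 p \<in> wt_le d}"

lemma fock_wt_le_mono: "d \<le> d' \<Longrightarrow> fock_wt_le d \<subseteq> fock_wt_le d'"
  by (force simp: fock_wt_le_def wt_le_def)

lemma fock_wt_le_exists: "\<exists>D::nat. p \<in> fock_wt_le (int D)"
proof -
  obtain d where "p \<in> fock_wt_le d"
    using wt_le_exists[of "Poly_Mapping.single 0 p"] by (auto simp: fock_wt_le_def)
  then have "p \<in> fock_wt_le (int (nat d))"
    using fock_wt_le_mono[of d "int (nat d)"] by auto
  then show ?thesis ..
qed

lemma fock_wt_le_exp_a_pos: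
  assumes "p \<in> fock_wt_le d"
  shows "fock_exp (fock_mode c a_pos) k p \<in> fock_wt_le (d - int k)"
proof -
  have "ops_exp (mode_series c a_pos) k (Poly_Mapping.single 0 p) \<in> wt_le (d - int k)"
    using assms unfolding ops_exp_def fock_wt_le_def
    by (intro wt_le_sum wt_le_scaleL wt_le_ops_power_a_pos) auto
  then show ?thesis
    by (simp add: ops_exp_single a_pos_zero fock_wt_le_def)
qed

text \<open>In degree k the exponential lowers weights by k, and no monomial has negative weight.
  This truncates the annihilation sums at D.\<close>

lemma exp_a_pos_eq_0:
  assumes "p \<in> fock_wt_le (int D)" "k > D"
  shows "fock_exp (fock_mode c a_pos) k p = 0"
proof -
  have "Poly_Mapping.single 0 (fock_exp (fock_mode c a_pos) k p) \<in> wt_le (int D - int k)"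
    using fock_wt_le_exp_a_pos[OF assms(1)] by (simp add: fock_wt_le_def)
  from wt_le_negative[OF this] assms(2) show ?thesis
    by simp
qed

subsection \<open>Products of vertex operators\<close>

definition x_coeff :: "nat \<Rightarrow> fld"
  where "x_coeff r = inverse q_half ^ r / qint r"

definition k_coeff :: "nat \<Rightarrow> fld"
  where "k_coeff r = (q_var - inverse q_var) * (- (q_half ^ r) / (1 + q_var ^ (2 * r)))"

text \<open>Extension by 0 to negative exponents absorbs the side conditions on summation
  ranges.\<close>

definition creation_part :: "int \<Rightarrow> fock"
  where "creation_part n = (if n \<ge> 0 then creation_coeff x_coeff (nat n) else 0)"

definition annihilation_part :: "nat \<Rightarrow> fock \<Rightarrow> fock"
  where "annihilation_part = fock_exp (fock_mode (\<lambda>r. - x_coeff r + k_coeff r) a_pos)"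

lemma annihilation_part_mult:
  "annihilation_part k (p * p') = (\<Sum>i\<le>k. annihilation_part i p * annihilation_part (k - i) p')"
  unfolding annihilation_part_def by (rule exp_a_pos_mult)

lemma annihilation_part_creation_part:
  "annihilation_part k (creation_part n) = one_minus_sq_coeff k * creation_part (n - int k)"
proof -
  have "annihilation_part k (creation_coeff x_coeff j) =
      (if k \<le> j then one_minus_sq_coeff k * creation_coeff x_coeff (j - k) else 0)" for j
    unfolding annihilation_part_def
    by (rule exp_a_pos_creation_coeff) (unfold x_coeff_def k_coeff_def, rule contraction_coefficient)
  moreover have "annihilation_part k 0 = 0"
    unfolding annihilation_part_def by (rule a_pos.exp_zero)
  ultimately show ?thesis
    by (auto simp: creation_part_def nat_diff_distrib)
qed

text \<open>The zero mode contributes z^\<beta> and the annihilation factor z^(-i), so the creation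
  factor must supply the exponent n - \<beta> + i.\<close>

lemma x_plus_single:
  assumes "p \<in> fock_wt_le (int D)"
  shows "x_plus n (Poly_Mapping.single \<beta> p) = Poly_Mapping.single (\<beta> + 2)
    (\<Sum>i\<le>D. creation_part (n - \<beta> + int i) * fock_exp (fock_mode (\<lambda>r. - x_coeff r) a_pos) i p)"
proof -
  let ?E = "fock_exp (fock_mode (\<lambda>r. - x_coeff r) a_pos)"
  let ?P = "in_z_inverse (ops_exp (mode_series (\<lambda>r. - x_coeff r) a_pos))"
  let ?M = "in_z (ops_exp (mode_series x_coeff a_neg))"
  let ?v = "Poly_Mapping.single \<beta> p"
  have M: "?M m (Poly_Mapping.single \<gamma> p) = Poly_Mapping.single \<gamma> (creation_part m * p)" for m \<gamma> p
    by (simp add: in_z_def ops_exp_single a_neg_zero exp_a_neg creation_part_def)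
  have P0: "?P m 0 = 0" for m
    by (intro linearL_zero linearL_in_z_inverse linearL_exp_a_pos)
  have P: "(?P \<odot> e_alpha_z_partial) l ?v =
      (if l \<le> \<beta> then Poly_Mapping.single (\<beta> + 2) (?E (nat (\<beta> - l)) p) else 0)" for l
  proof -
    \<comment> \<open>On this vector \<open>e_alpha_z_partial\<close> is nonzero only at exponent
      \<beta>, which forces m = l - \<beta>.\<close>
    have "(?P \<odot> e_alpha_z_partial) l ?v = (\<Sum>m\<in>{l - \<beta>}. ?P m (e_alpha_z_partial (l - m) ?v))"
      unfolding prod1_apply
      by (rule Sum_any.expand_superset)
        (auto simp: e_alpha_z_partial_eq lookup_single P0 when_def split: if_splits)
    then show ?thesis
      by (simp add: e_alpha_z_partial_eq in_z_inverse_def ops_exp_single a_pos_zero)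
  qed
  let ?f = "\<lambda>m. ?M m ((?P \<odot> e_alpha_z_partial) (n - m) ?v)"
  have f: "?f m = (if n - m \<le> \<beta> then Poly_Mapping.single (\<beta> + 2)
      (creation_part m * ?E (nat (\<beta> - (n - m))) p) else 0)" for m
    unfolding P using M[of m _ 0] by (simp add: M)
  have "x_plus n ?v = Sum_any ?f"
    unfolding x_plus_def x_coeff_def[symmetric] by (simp only: prod1_apply)
  also have "\<dots> = sum ?f ((\<lambda>i. n - \<beta> + int i) ` {..D})"
  proof (rule Sum_any.expand_superset)
    show "{m. ?f m \<noteq> 0} \<subseteq> (\<lambda>i. n - \<beta> + int i) ` {..D}"
    proof
      fix m assume "m \<in> {m. ?f m \<noteq> 0}"
      then have 1: "n - m \<le> \<beta>" and 2: "?E (nat (\<beta> - (n - m))) p \<noteq> 0"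
        unfolding f by (auto split: if_splits)
      from 2 have "nat (\<beta> - (n - m)) \<le> D"
        using exp_a_pos_eq_0[OF assms] by (meson not_le)
      with 1 show "m \<in> (\<lambda>i. n - \<beta> + int i) ` {..D}"
        by (intro image_eqI[of _ _ "nat (\<beta> - (n - m))"]) auto
    qed
  qed simp
  also have "\<dots> = (\<Sum>i\<le>D. ?f (n - \<beta> + int i))"
    by (subst sum.reindex) (auto simp: inj_on_def)
  also have "\<dots> = Poly_Mapping.single (\<beta> + 2) (\<Sum>i\<le>D. creation_part (n - \<beta> + int i) * ?E i p)"
    unfolding f single_sum by (intro sum.cong) auto
  finally show ?thesis .
qed

lemma x_hat_single:
  assumes "p \<in> fock_wt_le (int D)"
  shows "x_hat n (Poly_Mapping.single \<beta> p) = Poly_Mapping.single (\<beta> + 2)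
    (\<Sum>k\<le>D. creation_part (n - \<beta> + int k) * annihilation_part k p)"
proof -
  let ?E = "fock_exp (fock_mode (\<lambda>r. - x_coeff r) a_pos)"
  let ?F = "fock_exp (fock_mode k_coeff a_pos)"
  let ?v = "Poly_Mapping.single \<beta> p"
  have k: "k_hat l ?v = (if l \<le> 0 then Poly_Mapping.single \<beta> (?F (nat (- l)) p) else 0)" for l
    unfolding k_hat_def k_coeff_def[symmetric]
    by (simp add: in_z_inverse_def ops_exp_single a_pos_zero)
  let ?f = "\<lambda>m. x_plus m (k_hat (n - m) ?v)"
  have f: "?f m = (if n \<le> m then x_plus m (Poly_Mapping.single \<beta> (?F (nat (m - n)) p)) else 0)" for m
    using linearL_zero[OF linearL_x_plus] by (simp add: k)
  have "x_hat n ?v = Sum_any ?f"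
    by (simp add: x_hat_def prod1_apply)
  also have "\<dots> = sum ?f ((\<lambda>h. n + int h) ` {..D})"
  proof (rule Sum_any.expand_superset)
    show "{m. ?f m \<noteq> 0} \<subseteq> (\<lambda>h. n + int h) ` {..D}"
    proof
      fix m assume "m \<in> {m. ?f m \<noteq> 0}"
      then have 1: "n \<le> m" and 2: "?F (nat (m - n)) p \<noteq> 0"
        unfolding f using linearL_zero[OF linearL_x_plus] by (auto split: if_splits)
      from 2 have "nat (m - n) \<le> D"
        using exp_a_pos_eq_0[OF assms] by (meson not_le)
      with 1 show "m \<in> (\<lambda>h. n + int h) ` {..D}"
        by (intro image_eqI[of _ _ "nat (m - n)"]) auto
    qed
  qed simp
  also have "\<dots> = (\<Sum>h\<le>D. x_plus (n + int h) (Poly_Mapping.single \<beta> (?F h p)))"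
    by (subst sum.reindex) (auto simp: inj_on_def f)
  also have "\<dots> = (\<Sum>h\<le>D. Poly_Mapping.single (\<beta> + 2)
      (\<Sum>i\<le>D - h. creation_part (n - \<beta> + int (i + h)) * ?E i (?F h p)))"
  proof (intro sum.cong refl)
    fix h assume "h \<in> {..D}"
    \<comment> \<open>The degree h part of \<open>k_hat\<close> has already lowered the weight by h;
      the sharper bound makes the double sum triangular, ready to be regrouped by total
      degree.\<close>
    then have "?F h p \<in> fock_wt_le (int (D - h))"
      using fock_wt_le_exp_a_pos[OF assms] by (simp add: of_nat_diff)
    from x_plus_single[OF this] show "x_plus (n + int h) (Poly_Mapping.single \<beta> (?F h p)) =
        Poly_Mapping.single (\<beta> + 2)
          (\<Sum>i\<le>D - h. creation_part (n - \<beta> + int (i + h)) * ?E i (?F h p))"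
      by (simp add: algebra_simps)
  qed
  also have "\<dots> = Poly_Mapping.single (\<beta> + 2)
      (\<Sum>k\<le>D. \<Sum>i\<le>k. creation_part (n - \<beta> + int (i + (k - i))) * ?E i (?F (k - i) p))"
    unfolding single_sum[symmetric]
    by (subst sum_triangle_swap, subst sum_triangle_diagonal) (rule refl)
  also have "\<dots> = Poly_Mapping.single (\<beta> + 2)
      (\<Sum>k\<le>D. creation_part (n - \<beta> + int k) * annihilation_part k p)"
    unfolding annihilation_part_def exp_a_pos_compose[symmetric] sum_distrib_left
    by (intro arg_cong[where f = "Poly_Mapping.single (\<beta> + 2)"] sum.cong) auto
  finally show ?thesis .
qed

text \<open>
  The coefficients of the normally ordered product of two copies of \<open>x(z)\<close>, without the factor \<open>z\<^sub>1\<^sup>2\<close>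
  that comes from \<open>z\<^sub>1\<^sup>\<partial> e\<^sup>\<alpha>\<close>; this factor is the shift \<open>m - 2\<close> in \<open>x_hat_x_hat_single\<close>.
\<close>

definition normal_ordered :: "nat \<Rightarrow> int \<Rightarrow> fock \<Rightarrow> int \<Rightarrow> int \<Rightarrow> fock"
  where "normal_ordered D \<beta> p m n = (\<Sum>b\<le>D. \<Sum>h\<le>D. creation_part (m - \<beta> + int b) *
    (creation_part (n - \<beta> + int h) * annihilation_part b (annihilation_part h p)))"

lemma normal_ordered_bound:
  assumes "normal_ordered D \<beta> p m n \<noteq> 0"
  shows "\<beta> - int D \<le> m \<and> \<beta> - int D \<le> n"
proof -
  from assms obtain b h where "b \<le> D" "h \<le> D" "creation_part (m - \<beta> + int b) \<noteq> 0"
    "creation_part (n - \<beta> + int h) \<noteq> 0"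
    unfolding normal_ordered_def
    by (force elim!: sum.not_neutral_contains_not_neutral)
  then show ?thesis
    by (auto simp: creation_part_def split: if_splits)
qed

text \<open>The annihilation part of the outer operator acts on the creation part of the inner one
  by contraction and on the rest unchanged. The outer zero mode sees weight \<beta> + 2, whence the
  shift m - 2.\<close>

lemma x_hat_x_hat_single:
  assumes p: "p \<in> fock_wt_le (int D)"
  shows "x_hat m (x_hat n (Poly_Mapping.single \<beta> p)) = Poly_Mapping.single (\<beta> + 4)
    (\<Sum>a\<le>2. one_minus_sq_coeff a * normal_ordered D \<beta> p (m - 2 + int a) (n - int a))"
proof -
  let ?S = creation_part and ?U = annihilation_part and ?g = one_minus_sq_coeff
  define q where "q = (\<Sum>h\<le>D. ?S (n - \<beta> + int h) * ?U h p)"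
  obtain D' where "q \<in> fock_wt_le (int D')"
    using fock_wt_le_exists by blast
  \<comment> \<open>At least D', so that \<open>x_hat_single\<close> applies to q, and at least D +
    2, so that M - a \<ge> D for the contraction degrees a \<le> 2.\<close>
  define M where "M = max D' (D + 2)"
  have q: "q \<in> fock_wt_le (int M)"
    using \<open>q \<in> fock_wt_le (int D')\<close> fock_wt_le_mono[of "int D'" "int M"] by (auto simp: M_def)
  have U0: "?U b (?U h p) = 0" if "b > D" for b h
  proof -
    have "?U h p \<in> fock_wt_le (int D)"
      using fock_wt_le_exp_a_pos[OF p] fock_wt_le_mono[of "int D - int h" "int D"]
      unfolding annihilation_part_def by auto
    with that show ?thesis
      unfolding annihilation_part_def by (intro exp_a_pos_eq_0)
  qed
  define F where "F a b = (\<Sum>h\<le>D. ?g a * (?S (m - 2 + int a - \<beta> + int b) *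
      (?S (n - int a - \<beta> + int h) * ?U b (?U h p))))" for a b
  have "?S (m - (\<beta> + 2) + int k) * ?U k q = (\<Sum>a\<le>k. F a (k - a))" for k
  proof -
    have "?U k q = (\<Sum>h\<le>D. \<Sum>a\<le>k. ?g a * ?S (n - \<beta> + int h - int a) * ?U (k - a) (?U h p))"
      unfolding q_def annihilation_part_def a_pos.exp_sum
      unfolding annihilation_part_def[symmetric]
      by (simp only: annihilation_part_mult annihilation_part_creation_part)
    also have "\<dots> = (\<Sum>a\<le>k. \<Sum>h\<le>D. ?g a * ?S (n - \<beta> + int h - int a) * ?U (k - a) (?U h p))"
      by (rule sum.swap)
    finally show ?thesis
      by (simp add: F_def sum_distrib_left algebra_simps of_nat_diff)
  qed
  then have "(\<Sum>k\<le>M. ?S (m - (\<beta> + 2) + int k) * ?U k q) = (\<Sum>a\<le>M. \<Sum>b\<le>M - a. F a b)"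
    by (simp add: sum_triangle_diagonal)
  also have "\<dots> = (\<Sum>a\<le>2. \<Sum>b\<le>M - a. F a b)"
    by (rule sum.mono_neutral_right)
      (auto simp: M_def F_def one_minus_sq_coeff_def)
  \<comment> \<open>The terms with b > D vanish by \<open>U0\<close>, which makes the range of b
    independent of a.\<close>
  also have "\<dots> = (\<Sum>a\<le>2. \<Sum>b\<le>D. F a b)"
    by (intro sum.cong refl sum.mono_neutral_right)
      (auto simp: M_def F_def U0 not_le)
  also have "\<dots> = (\<Sum>a\<le>2. ?g a * normal_ordered D \<beta> p (m - 2 + int a) (n - int a))"
    by (simp add: F_def normal_ordered_def sum_distrib_left)
  finally show ?thesis
    by (simp only: x_hat_single[OF p] q_def[symmetric] x_hat_single[OF q])
      (simp add: add.commute)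
qed

section \<open>Truncation and vanishing on the diagonal\<close>

lemma Sum_any_telescope:
  fixes f :: "int \<Rightarrow> 'a::ab_group_add"
  assumes "finite {m. f m \<noteq> 0}"
  shows "Sum_any (\<lambda>m. f m - f (m + 1)) = 0"
proof -
  have bij: "bij (\<lambda>m::int. m + 1)"
    by (rule bijI') (auto intro: exI[of _ "y - 1" for y])
  have "finite {m. f (m + 1) \<noteq> 0}"
    using finite_vimageI[OF assms bij_is_inj[OF bij]] by (simp add: vimage_def)
  then have "Sum_any (\<lambda>m. f m + - f (m + 1)) = Sum_any f + Sum_any (\<lambda>m. - f (m + 1))"
    by (intro Sum_any.distrib) (use assms in auto)
  \<comment> \<open>Summation over all integers is invariant under the shift by one.\<close>
  also have "Sum_any (\<lambda>m. - f (m + 1)) = Sum_any (\<lambda>m. - f m)"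
    by (rule Sum_any.reindex_cong[OF bij, symmetric]) (auto simp: o_def)
  also have "Sum_any f + \<dots> = Sum_any (\<lambda>m. f m + - f m)"
    by (intro Sum_any.distrib[symmetric]) (use assms in auto)
  finally show ?thesis by simp
qed

text \<open>Truncation of each factor separately would bound m only in dependence on n; the normally
  ordered form bounds both exponents uniformly.\<close>

lemma x_hat_x_hat_bound: "\<exists>N. \<forall>m n. x_hat m (x_hat n v) \<noteq> 0 \<longrightarrow> N \<le> m \<and> N \<le> n"
proof (induction v rule: spc_induct)
  case zero
  then show ?case by (simp add: linearL_zero[OF linearL_x_hat])
next
  case (add \<beta> p v)
  then obtain N where N: "\<And>m n. x_hat m (x_hat n v) \<noteq> 0 \<Longrightarrow> N \<le> m \<and> N \<le> n"
    by blast
  obtain D where D: "p \<in> fock_wt_le (int D)"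
    using fock_wt_le_exists by blast
  have "\<beta> - int D \<le> m \<and> \<beta> - int D \<le> n"
    if "x_hat m (x_hat n (Poly_Mapping.single \<beta> p)) \<noteq> 0" for m n
  proof -
    from that have "(\<Sum>a\<le>2. one_minus_sq_coeff a *
        normal_ordered D \<beta> p (m - 2 + int a) (n - int a)) \<noteq> 0"
      unfolding x_hat_x_hat_single[OF D] by simp
    then obtain a where "a \<in> {..2}"
      "one_minus_sq_coeff a * normal_ordered D \<beta> p (m - 2 + int a) (n - int a) \<noteq> 0"
      by (rule sum.not_neutral_contains_not_neutral)
    with normal_ordered_bound[of D \<beta> p "m - 2 + int a" "n - int a"] show ?thesis
      by force
  qed
  then have "min N (\<beta> - int D) \<le> m \<and> min N (\<beta> - int D) \<le> n"
    if "x_hat m (x_hat n (Poly_Mapping.single \<beta> p + v)) \<noteq> 0" for m n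
    using N[of m n] that by (fastforce simp: linearL_add[OF linearL_x_hat])
  then show ?case by blast
qed

lemma x_hat_bound: "\<exists>N. \<forall>n. x_hat n v \<noteq> 0 \<longrightarrow> N \<le> n"
proof (induction v rule: spc_induct)
  case zero
  then show ?case by (simp add: linearL_zero[OF linearL_x_hat])
next
  case (add \<beta> p v)
  then obtain N where N: "\<And>n. x_hat n v \<noteq> 0 \<Longrightarrow> N \<le> n"
    by blast
  obtain D where D: "p \<in> fock_wt_le (int D)"
    using fock_wt_le_exists by blast
  have "\<beta> - int D \<le> n" if "x_hat n (Poly_Mapping.single \<beta> p) \<noteq> 0" for n
  proof -
    from that have "(\<Sum>k\<le>D. creation_part (n - \<beta> + int k) * annihilation_part k p) \<noteq> 0"
      unfolding x_hat_single[OF D] by simp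
    then obtain k where "k \<in> {..D}"
      "creation_part (n - \<beta> + int k) * annihilation_part k p \<noteq> 0"
      by (rule sum.not_neutral_contains_not_neutral)
    then show ?thesis by (auto simp: creation_part_def split: if_splits)
  qed
  then have "min N (\<beta> - int D) \<le> n" if "x_hat n (Poly_Mapping.single \<beta> p + v) \<noteq> 0" for n
    using N[of n] that by (fastforce simp: linearL_add[OF linearL_x_hat])
  then show ?case by blast
qed

lemma finite_x_hat_x_hat_terms: "finite {m. x_hat m (x_hat (k - m) v) \<noteq> 0}"
proof -
  obtain N where "\<And>m n. x_hat m (x_hat n v) \<noteq> 0 \<Longrightarrow> N \<le> m \<and> N \<le> n"
    using x_hat_x_hat_bound by blast
  then have "{m. x_hat m (x_hat (k - m) v) \<noteq> 0} \<subseteq> {N..k - N}"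
    by force
  then show ?thesis by (rule finite_subset) simp
qed

text \<open>Along m + n = k the factor (z_1 - z_2)^2 becomes the second difference f(m) - 2 f(m + 1)
  + f(m + 2) of a finitely supported f. It is the first difference of g, so its sum telescopes to
  0.\<close>

lemma specialize_x_hat_x_hat_single:
  "specialize (prod2 x_hat x_hat) k (Poly_Mapping.single \<beta> p) = 0"
proof -
  obtain D where D: "p \<in> fock_wt_le (int D)"
    using fock_wt_le_exists by blast
  define f where "f m = Poly_Mapping.single (\<beta> + 4) (normal_ordered D \<beta> p (m - 2) (k - m))" for m
  have fin: "finite {m. f m \<noteq> 0}"
  proof (rule finite_subset)
    \<comment> \<open>The lower bound on the first exponent m - 2 bounds m below, that on the second
      exponent k - m bounds it above.\<close>
    show "{m. f m \<noteq> 0} \<subseteq> {\<beta> - int D + 2..k - \<beta> + int D}"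
    proof
      fix m assume "m \<in> {m. f m \<noteq> 0}"
      then show "m \<in> {\<beta> - int D + 2..k - \<beta> + int D}"
        using normal_ordered_bound[of D \<beta> p "m - 2" "k - m"] by (auto simp: f_def)
    qed
  qed simp
  define g where "g m = f m - f (m + 1)" for m
  have "finite {m. f (m + 1) \<noteq> 0}"
    using finite_vimageI[OF fin, of "\<lambda>m. m + 1"] by (simp add: vimage_def)
  then have "finite {m. g m \<noteq> 0}"
    using fin by (rule_tac finite_subset[of _ "{m. f m \<noteq> 0} \<union> {m. f (m + 1) \<noteq> 0}"])
      (auto simp: g_def)
  have "x_hat m (x_hat (k - m) (Poly_Mapping.single \<beta> p)) = g m - g (m + 1)" for m
  proof -
    have "{..2} = {0, 1, 2::nat}" by auto
    then show ?thesis
      unfolding x_hat_x_hat_single[OF D]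
      by (simp add: one_minus_sq_coeff_def g_def f_def algebra_simps flip: single_add single_diff)
  qed
  then show ?thesis
    using Sum_any_telescope[OF \<open>finite {m. g m \<noteq> 0}\<close>] by (simp add: specialize_def prod2_def)
qed

lemma specialize_x_hat_x_hat: "specialize (prod2 x_hat x_hat) k v = 0"
proof (induction v rule: spc_induct)
  case zero
  show ?case by (simp add: specialize_def prod2_def linearL_zero[OF linearL_x_hat])
next
  case (add \<beta> p v)
  have "specialize (prod2 x_hat x_hat) k (Poly_Mapping.single \<beta> p + v) =
      specialize (prod2 x_hat x_hat) k (Poly_Mapping.single \<beta> p) + specialize (prod2 x_hat x_hat) k v"
    unfolding specialize_def prod2_def linearL_add[OF linearL_x_hat]
    by (intro Sum_any.distrib finite_x_hat_x_hat_terms)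
  with add show ?case by (simp add: specialize_x_hat_x_hat_single)
qed

theorem proposition2p3:
  shows "x_hat \<in> Hom_L_Lz \<and>
    prod2 x_hat x_hat \<in> Hom_L_Lzz \<and>
    (\<forall>k v. specialize (prod2 x_hat x_hat) k v = 0)"
  using linearL_x_hat x_hat_bound x_hat_x_hat_bound specialize_x_hat_x_hat
    linearL_compose[OF linearL_x_hat linearL_x_hat]
  by (simp add: Hom_L_Lz_def Hom_L_Lzz_def prod2_def[abs_def])

end
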